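(* Let $n\geq 1$ be a natural number with $n\equiv 0$, $1$ or $2 \pmod 4$. Then the group $SO(3)$ cannot act freely on the real projective space $\mathbb{R}P^n$.
   Context: $SO(3)$ is the group of rotations about the origin of $\mathbb{R}^3$. Actions are continuous; an action of $G$ on $X$ is free if all isotropy subgroups $G_x=\{g\in G: gx=x\}$ are trivial. *)

theory Defs
  imports "HOL-Analysis.Analysis" "HOL-Algebra.Group_Action"
begin

definition SO3 :: "(real ^ 3 ^ 3) monoid" where
  "SO3 = \<lparr>carrier = {A. rotation_matrix A}, mult = (**), one = mat 1\<rparr>"

definition SO3_top :: "(real ^ 3 ^ 3) topology" where
  "SO3_top = top_of_set (carrier SO3)"

lemma topspace_SO3_top [simp]: "topspace SO3_top = carrier SO3"
  by (simp add: SO3_top_def)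

lemma group_SO3: "group SO3"
proof (rule groupI)
  fix A :: "real ^ 3 ^ 3"
  assume "A \<in> carrier SO3"
  then have "transpose A \<in> carrier SO3" "transpose A \<otimes>\<^bsub>SO3\<^esub> A = \<one>\<^bsub>SO3\<^esub>"
    by (auto simp: SO3_def rotation_matrix_def orthogonal_matrix_def det_transpose)
  then show "\<exists>B\<in>carrier SO3. B \<otimes>\<^bsub>SO3\<^esub> A = \<one>\<^bsub>SO3\<^esub>"
    by blast
qed (auto simp: SO3_def rotation_matrix_def orthogonal_matrix_mul orthogonal_matrix_id
       det_mul matrix_mul_assoc)

definition quotient_topology :: "'a topology \<Rightarrow> ('a \<Rightarrow> 'b) \<Rightarrow> 'b topology" where
  "quotient_topology X q =
     topology (\<lambda>U. U \<subseteq> q ` topspace X \<and> openin X {x \<in> topspace X. q x \<in> U})"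

lemma openin_quotient_topology:
  "openin (quotient_topology X q) U \<longleftrightarrow>
     U \<subseteq> q ` topspace X \<and> openin X {x \<in> topspace X. q x \<in> U}"
proof -
  have "istopology (\<lambda>U. U \<subseteq> q ` topspace X \<and> openin X {x \<in> topspace X. q x \<in> U})"
    unfolding istopology_def
  proof (intro conjI allI impI)
    fix S T
    assume S: "S \<subseteq> q ` topspace X \<and> openin X {x \<in> topspace X. q x \<in> S}"
      and T: "T \<subseteq> q ` topspace X \<and> openin X {x \<in> topspace X. q x \<in> T}"
    show "S \<inter> T \<subseteq> q ` topspace X"
      using S by blast
    have "{x \<in> topspace X. q x \<in> S \<inter> T} =
        {x \<in> topspace X. q x \<in> S} \<inter> {x \<in> topspace X. q x \<in> T}"
      by blast
    then show "openin X {x \<in> topspace X. q x \<in> S \<inter> T}"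
      using S T by (simp add: openin_Int)
  next
    fix \<K>
    assume K: "\<forall>K\<in>\<K>. K \<subseteq> q ` topspace X \<and> openin X {x \<in> topspace X. q x \<in> K}"
    show "\<Union>\<K> \<subseteq> q ` topspace X"
      using K by blast
    have "{x \<in> topspace X. q x \<in> \<Union>\<K>} = (\<Union>K\<in>\<K>. {x \<in> topspace X. q x \<in> K})"
      by blast
    then show "openin X {x \<in> topspace X. q x \<in> \<Union>\<K>}"
      using K by auto
  qed
  then show ?thesis
    by (simp add: quotient_topology_def topology_inverse')
qed

lemma topspace_quotient_topology [simp]:
  "topspace (quotient_topology X q) = q ` topspace X"
proof
  show "topspace (quotient_topology X q) \<subseteq> q ` topspace X"
    using openin_quotient_topology[of X q] openin_topspace by blast
  have "{x \<in> topspace X. q x \<in> q ` topspace X} = topspace X"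
    by blast
  then show "q ` topspace X \<subseteq> topspace (quotient_topology X q)"
    by (intro openin_subset) (simp add: openin_quotient_topology)
qed

lemma quotient_map_quotient_topology: "quotient_map X (quotient_topology X q) q"
  by (auto simp: quotient_map_def openin_quotient_topology)

definition antipodal_class :: "(nat \<Rightarrow> real) \<Rightarrow> (nat \<Rightarrow> real) set" where
  "antipodal_class x = {x, (\<lambda>i. - x i)}"

text \<open>\<^term>\<open>nsphere n\<close> is the unit sphere of the (n+1)-dimensional space, with coordinates
  indexed by 0, ..., n, so the quotient below is n-dimensional projective space.\<close>

definition real_projective_space :: "nat \<Rightarrow> (nat \<Rightarrow> real) set topology" where
  "real_projective_space n = quotient_topology (nsphere n) antipodal_class"

text \<open>An action in the sense of \<^const>\<open>group_action\<close> consists of bijections of the underlying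
  set that are extensional, i.e. \<^const>\<open>undefined\<close> off that set. Continuity is joint.\<close>

definition continuous_action ::
  "('g, 'm) monoid_scheme \<Rightarrow> 'g topology \<Rightarrow> 'a topology \<Rightarrow> ('g \<Rightarrow> 'a \<Rightarrow> 'a) \<Rightarrow> bool" where
  "continuous_action G T X \<phi> \<longleftrightarrow>
     topspace T = carrier G \<and> group_action G (topspace X) \<phi> \<and>
     continuous_map (prod_topology T X) X (\<lambda>(g, x). \<phi> g x)"

definition free_action ::
  "('g, 'm) monoid_scheme \<Rightarrow> 'a set \<Rightarrow> ('g \<Rightarrow> 'a \<Rightarrow> 'a) \<Rightarrow> bool" where
  "free_action G E \<phi> \<longleftrightarrow> (\<forall>x\<in>E. stabilizer G \<phi> x = {\<one>\<^bsub>G\<^esub>})"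

end

theory Submission
  imports Defs "HOL-Homology.Homology"
begin

text \<open>
Suppose that \<open>SO(3)\<close> acts freely on \<open>\<real>P\<^sup>n\<close>. The half turns about the axes \<open>u \<in> S\<^sup>2\<close> form a family of
homeomorphisms of \<open>\<real>P\<^sup>n\<close>, and this family lifts to a continuous map \<open>G: S\<^sup>2 \<times> S\<^sup>n \<rightarrow> S\<^sup>n\<close> that is odd in the second
variable. Each \<open>G (u, -)\<close> squares to the identity or to the antipodal map, with the same alternative for all \<open>u\<close>.

In the first case \<open>G (u, -)\<close> is an involution \<open>T\<close> of \<open>S\<^sup>n\<close> that, by freeness, never takes \<open>x\<close> to \<open>x\<close> or \<open>- x\<close>. This is
impossible in every positive dimension (\<open>involution_of_sphere_meets_antipode\<close>): the map \<open>x + T x\<close>, suitably normalized, is homotopic to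
the identity but factors through \<open>S\<^sup>n / T\<close>, so that its degree would have to be both \<open>1\<close> and even.

In the second case \<open>G (-u, -)\<close>, being the inverse of \<open>G (u, -)\<close>, is \<open>- G (u, -)\<close>, so \<open>G\<close> is odd in both variables. By the
theorem of Hopf and Stiefel (\<open>bi_odd_map_binomials_odd\<close>) the numbers \<open>n choose 1\<close> and \<open>n choose 2\<close> are then odd, and \<open>n\<close> is \<open>3\<close> modulo \<open>4\<close>.

Both topological facts are proved with singular chains modulo two. The tool is a tower of chains for a free involution, that is, the
chain-level shadow of a map from the infinite-dimensional sphere with its antipodal involution. On \<open>S\<^sup>n\<close> such towers exist up to degree \<open>n\<close>
because the homology below degree \<open>n\<close> vanishes, and for the antipodal map
the top class of every tower is the nonzero class of \<open>S\<^sup>n\<close> (\<open>tower_top_essential\<close>). Towers are natural for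
equivariant maps, which replaces the homology of quotient spaces; double towers in two directions replace the cohomology ring
of a product of projective spaces.

The lifting \<open>G\<close> is explicit: for a small angle the lift of a rotation is the representative closest to the given point, and
a half turn is reached by repeated doubling of the angle (\<open>half_turn_lift_exists\<close>).
\<close>

section \<open>Chains modulo two\<close>

text \<open>Homology modulo two is done with integral chains: a chain represents zero over the field
with two elements exactly if it is twice another chain. In this way the integral homology of spheres
can be used directly, and a statement "modulo two" is the evenness of a difference.\<close>

definition even_chain :: "'a chain \<Rightarrow> bool" where
  "even_chain c \<longleftrightarrow> (\<exists>w. c = w + w)"

lemma even_chain_0 [simp]: "even_chain 0"
  unfolding even_chain_def by (metis add_0)

lemma even_chain_double [simp]: "even_chain (c + c)"
  unfolding even_chain_def by blast

lemma even_chain_add: "even_chain a \<Longrightarrow> even_chain b \<Longrightarrow> even_chain (a + b)"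
proof -
  assume "even_chain a" "even_chain b"
  then obtain v w where "a = v + v" "b = w + w"
    unfolding even_chain_def by blast
  then have "a + b = (v + w) + (v + w)"
    by (simp add: algebra_simps)
  then show ?thesis
    by simp
qed

lemma even_chain_minus: "even_chain a \<Longrightarrow> even_chain (- a)"
  unfolding even_chain_def by (metis minus_add_distrib)

lemma even_chain_minus_iff [simp]: "even_chain (- a) \<longleftrightarrow> even_chain a"
  using even_chain_minus [of a] even_chain_minus [of "- a"] by auto

lemma even_chain_diff: "even_chain a \<Longrightarrow> even_chain b \<Longrightarrow> even_chain (a - b)"
  using even_chain_add [of a "- b"] by simp

lemma even_chain_chain_map: "even_chain c \<Longrightarrow> even_chain (chain_map p f c)"
  unfolding even_chain_def by (metis chain_map_add)

lemma even_chain_cmul: "even_chain c \<Longrightarrow> even_chain (frag_cmul k c)"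
  unfolding even_chain_def by (metis frag_cmul_distrib2)

lemma frag_double: "c + c = frag_cmul 2 c" for c :: "'a chain"
  using frag_cmul_distrib [of 1 1 c] by simp

lemma even_chain_even_cmul: "even k \<Longrightarrow> even_chain (frag_cmul k c)"
  by (auto elim!: evenE simp: even_chain_def frag_double intro: exI [of _ "frag_cmul (k div 2) c"])

lemma frag_double_eq_0: "c + c = 0 \<longleftrightarrow> c = 0" for c :: "'a chain"
  by (simp add: frag_double)

text \<open>Halving an even chain of \<open>X\<close> does not leave \<open>X\<close>: doubling does not change the set of
simplices that occur.\<close>

lemma singular_chain_half: "singular_chain p X (w + w) \<longleftrightarrow> singular_chain p X w"
proof -
  have "Poly_Mapping.keys (frag_cmul 2 w) = Poly_Mapping.keys w"
    by (auto simp: in_keys_iff)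
  then show ?thesis
    by (simp add: singular_chain_def frag_double)
qed

text \<open>The chains that represent a boundary over the field with two elements.\<close>

definition bounds_mod2 :: "nat \<Rightarrow> 'a topology \<Rightarrow> 'a chain \<Rightarrow> bool" where
  "bounds_mod2 p X c \<longleftrightarrow>
     (\<exists>v. singular_chain (Suc p) X v \<and> even_chain (c - chain_boundary (Suc p) v))"

lemma bounds_mod2_even: "even_chain c \<Longrightarrow> bounds_mod2 p X c"
  unfolding bounds_mod2_def by (intro exI [of _ 0]) simp

lemma bounds_mod2_add: "bounds_mod2 p X a \<Longrightarrow> bounds_mod2 p X b \<Longrightarrow> bounds_mod2 p X (a + b)"
proof -
  assume "bounds_mod2 p X a" "bounds_mod2 p X b"
  then obtain v w where v: "singular_chain (Suc p) X v" "even_chain (a - chain_boundary (Suc p) v)"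
    and w: "singular_chain (Suc p) X w" "even_chain (b - chain_boundary (Suc p) w)"
    unfolding bounds_mod2_def by blast
  have "even_chain (a + b - chain_boundary (Suc p) (v + w))"
    using even_chain_add [OF v(2) w(2)] by (simp add: chain_boundary_add algebra_simps)
  then show ?thesis
    unfolding bounds_mod2_def using singular_chain_add [OF v(1) w(1)] by blast
qed

lemma bounds_mod2_minus: "bounds_mod2 p X a \<Longrightarrow> bounds_mod2 p X (- a)"
proof -
  assume "bounds_mod2 p X a"
  then obtain v where v: "singular_chain (Suc p) X v" "even_chain (a - chain_boundary (Suc p) v)"
    unfolding bounds_mod2_def by blast
  have "even_chain (- a - chain_boundary (Suc p) (- v))"
    using v(2) even_chain_minus_iff [of "a - chain_boundary (Suc p) v"]
    by (simp add: chain_boundary_minus)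
  then show ?thesis
    unfolding bounds_mod2_def using v(1) singular_chain_minus by blast
qed

lemma bounds_mod2_diff: "bounds_mod2 p X a \<Longrightarrow> bounds_mod2 p X b \<Longrightarrow> bounds_mod2 p X (a - b)"
  using bounds_mod2_add [of p X a "- b"] bounds_mod2_minus by fastforce

lemma bounds_mod2_relboundary: "singular_relboundary p X {} c \<Longrightarrow> bounds_mod2 p X c"
  unfolding bounds_mod2_def singular_boundary by force

lemma bounds_mod2_even_diff: "bounds_mod2 p X b \<Longrightarrow> even_chain (a - b) \<Longrightarrow> bounds_mod2 p X a"
  using bounds_mod2_add [of p X b "a - b"] bounds_mod2_even by fastforce

lemma bounds_mod2_chain_map:
  assumes "bounds_mod2 p X c" "continuous_map X Y f"
  shows "bounds_mod2 p Y (chain_map p f c)"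
proof -
  obtain v where v: "singular_chain (Suc p) X v" "even_chain (c - chain_boundary (Suc p) v)"
    using assms unfolding bounds_mod2_def by blast
  have "chain_map p f (c - chain_boundary (Suc p) v)
      = chain_map p f c - chain_boundary (Suc p) (chain_map (Suc p) f v)"
    using chain_boundary_chain_map [OF v(1), of f] by (simp add: chain_map_diff)
  then have "even_chain (chain_map p f c - chain_boundary (Suc p) (chain_map (Suc p) f v))"
    using even_chain_chain_map [OF v(2), of p f] by simp
  then show ?thesis
    unfolding bounds_mod2_def using singular_chain_chain_map [OF v(1) assms(2)] by blast
qed

lemma bounds_mod2_cong:
  assumes "bounds_mod2 p X (a - b)"
  shows "bounds_mod2 p X a \<longleftrightarrow> bounds_mod2 p X b"
  using assms bounds_mod2_add [of p X "a - b" b] bounds_mod2_diff [of p X a "a - b"] by auto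

text \<open>Connectivity in the only form that the constructions below use: they extend chains one degree at
a time and never look above a fixed degree. A contractible space is acyclic below every degree,
the \<open>n\<close>-sphere is acyclic below degree \<open>n\<close>.\<close>

definition acyclic_below :: "nat \<Rightarrow> 'a topology \<Rightarrow> bool" where
  "acyclic_below m X \<longleftrightarrow> path_connected_space X \<and>
     (\<forall>p c. 0 < p \<longrightarrow> p < m \<longrightarrow> singular_relcycle p X {} c \<longrightarrow> singular_relboundary p X {} c)"

lemma relboundary_of_trivial_homology:
  assumes "trivial_group (homology_group (int p) X)" "singular_relcycle p X {} c"
  shows "singular_relboundary p X {} c"
proof -
  have "homologous_rel_set p X {} c \<in> carrier (homology_group (int p) X)"
    using assms(2) by (auto simp: carrier_relative_homology_group)
  then have "homologous_rel_set p X {} c = singular_relboundary_set p X {}"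
    using assms(1) unfolding trivial_group_def by simp
  then show ?thesis
    by (simp add: homologous_rel_set_eq_relboundary)
qed

lemma acyclic_below_contractible:
  assumes "contractible_space X"
  shows "acyclic_below m X"
  unfolding acyclic_below_def
proof (intro conjI allI impI)
  show "path_connected_space X"
    by (simp add: assms contractible_imp_path_connected_space)
next
  fix p :: nat and c :: "'a chain"
  assume "0 < p" and c: "singular_relcycle p X {} c"
  have "trivial_group (homology_group (int p) X)"
    using trivial_reduced_homology_group_contractible_space [OF assms, of "int p"] \<open>0 < p\<close>
    by (simp add: un_reduced_homology_group)
  then show "singular_relboundary p X {} c"
    using c relboundary_of_trivial_homology by blast
qed

text \<open>In a path connected space any two points are homologous, so degree zero homology is generated by
the class of one point. Together with the next lemma this makes it torsion free.\<close>

lemma zero_chain_homologous_multiple: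
  assumes "path_connected_space X" "singular_chain 0 X y" "singular_simplex 0 X s"
  shows "\<exists>k. singular_relboundary 0 X {} (y - frag_cmul k (frag_of s))"
  using assms(2) unfolding singular_chain_def
proof (induction y rule: frag_induction)
  case zero
  show ?case by (intro exI [of _ 0]) simp
next
  case (one t)
  then show ?case
    using iso_integer_zeroth_homology_group_aux [OF assms(1) _ assms(3)]
    by (intro exI [of _ 1]) (simp add: homologous_rel_def)
next
  case (diff a b)
  then obtain k l where "singular_relboundary 0 X {} (a - frag_cmul k (frag_of s))"
      "singular_relboundary 0 X {} (b - frag_cmul l (frag_of s))"
    by blast
  then have "singular_relboundary 0 X {} ((a - frag_cmul k (frag_of s)) - (b - frag_cmul l (frag_of s)))"
    by (rule singular_relboundary_diff)
  then show ?case
    by (intro exI [of _ "k - l"]) (simp add: frag_cmul_diff_distrib algebra_simps)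
qed

text \<open>Map everything to a one-point space; there the boundary of a 1-chain vanishes.\<close>

lemma multiple_of_point_not_boundary:
  assumes "singular_relboundary 0 X {} (frag_cmul k (frag_of s))" 
  shows "k = 0"
proof -
  let ?U = "discrete_topology {()}"
  have "singular_relboundary 0 ?U {} (chain_map 0 (\<lambda>x. ()) (frag_cmul k (frag_of s)))"
    using assms by (rule singular_relboundary_chain_map) auto
  then have "chain_map 0 (\<lambda>x. ()) (frag_cmul k (frag_of s)) = 0"
    using singular_boundary_singleton [of ?U "()" 0] by auto
  then show ?thesis
    by simp
qed

lemma zero_chain_torsion_free:
  assumes X: "path_connected_space X" and y: "singular_chain 0 X y"
    and yy: "singular_relboundary 0 X {} (y + y)"
  shows "singular_relboundary 0 X {} y"
proof (cases "y = 0")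
  case False
  then obtain s where s: "singular_simplex 0 X s"
    using y keys_eq_empty [of y] unfolding singular_chain_def by blast
  obtain k where k: "singular_relboundary 0 X {} (y - frag_cmul k (frag_of s))"
    using zero_chain_homologous_multiple [OF X y s] by blast
  have "singular_relboundary 0 X {} (y + y - ((y - frag_cmul k (frag_of s)) + (y - frag_cmul k (frag_of s))))"
    using singular_relboundary_diff [OF yy singular_relboundary_add [OF k k]] .
  also have "y + y - ((y - frag_cmul k (frag_of s)) + (y - frag_cmul k (frag_of s)))
     = frag_cmul (k + k) (frag_of s)"
    by (simp only: frag_cmul_distrib) (simp add: algebra_simps)
  finally have "k + k = 0"
    by (rule multiple_of_point_not_boundary)
  then show ?thesis using k by simp
qed simp

text \<open>This is the part of the universal coefficient theorem that is needed. If \<open>\<partial>c = 2y\<close>, then \<open>2\<partial>y = 0\<close>,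
so \<open>y\<close> is an integral cycle in a degree in which cycles bound (or, in degree zero, in which
homology is torsion free and \<open>2y\<close> bounds). If \<open>y = \<partial>d\<close>, then \<open>c - 2d\<close> is an integral cycle.\<close>

lemma mod2_cycle_lifts:
  assumes X: "acyclic_below m X" and p: "0 < p" "p \<le> m"
    and c: "singular_chain p X c" and ev: "even_chain (chain_boundary p c)"
  obtains z where "singular_relcycle p X {} z" "even_chain (c - z)"
proof -
  obtain y where y: "chain_boundary p c = y + y"
    using ev unfolding even_chain_def by blast
  have sy: "singular_chain (p - Suc 0) X y"
    using singular_chain_boundary [OF c] by (simp add: y singular_chain_half)
  have "chain_boundary (p - Suc 0) (y + y) = 0"
    using chain_boundary_boundary [OF c] y by simp
  then have cy: "singular_relcycle (p - Suc 0) X {} y"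
    using sy by (simp add: singular_cycle chain_boundary_add frag_double_eq_0)
  have "singular_relboundary (p - Suc 0) X {} y"
  proof (cases "p = Suc 0")
    case True
    then have "singular_relboundary 0 X {} (y + y)"
      using c y unfolding singular_boundary by auto
    then show ?thesis
      using zero_chain_torsion_free [of X y] X sy True by (simp add: acyclic_below_def)
  next
    case False
    then show ?thesis
      using X cy p unfolding acyclic_below_def by auto
  qed
  then obtain d where d: "singular_chain p X d" "chain_boundary p d = y"
    using p unfolding singular_boundary by auto
  show thesis
  proof
    show "singular_relcycle p X {} (c - (d + d))"
      using c d by (simp add: singular_cycle singular_chain_add singular_chain_diff
            chain_boundary_diff chain_boundary_add y)
    show "even_chain (c - (c - (d + d)))" by simp
  qed
qed

lemma bounds_mod2_if_acyclic:
  assumes X: "acyclic_below m X" and p: "0 < p" "p < m"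
    and c: "singular_chain p X c" and ev: "even_chain (chain_boundary p c)"
  shows "bounds_mod2 p X c"
proof -
  obtain z where "singular_relcycle p X {} z" "even_chain (c - z)"
    using mod2_cycle_lifts [OF X p(1) _ c ev] p by auto
  then show ?thesis
    using X p bounds_mod2_even_diff bounds_mod2_relboundary unfolding acyclic_below_def by blast
qed

lemma bounds_mod2_two_points:
  assumes "path_connected_space X" "singular_simplex 0 X s" "singular_simplex 0 X t"
  shows "bounds_mod2 0 X (frag_of s + frag_of t)"
proof -
  have "bounds_mod2 0 X (frag_of s - frag_of t)"
    using iso_integer_zeroth_homology_group_aux [OF assms]
    by (simp add: homologous_rel_def bounds_mod2_relboundary)
  moreover have "frag_of s + frag_of t - (frag_of s - frag_of t) = frag_of t + frag_of t"
    by simp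
  ultimately show ?thesis
    using bounds_mod2_even_diff [of 0 X "frag_of s - frag_of t" "frag_of s + frag_of t"]
      even_chain_double [of "frag_of t"] by simp
qed

lemma chain_map_involution:
  assumes "singular_chain p X c" "\<And>x. x \<in> topspace X \<Longrightarrow> f (f x) = x"
  shows "chain_map p f (chain_map p f c) = c"
  using chain_map_id_gen [of p X c "f \<circ> f"] assms by (simp add: chain_map_compose)

section \<open>Towers of chains\<close>

text \<open>The model, for the sphere and the antipodal map \<open>f\<close>, is the sequence of hemispheres of increasing dimension, starting
with a point: the boundary of a hemisphere is the sphere one dimension lower, which is the union of two antipodal hemispheres.\<close>

definition tower :: "nat \<Rightarrow> 'a topology \<Rightarrow> ('a \<Rightarrow> 'a) \<Rightarrow> (nat \<Rightarrow> 'a chain) \<Rightarrow> bool" where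
  "tower n X f c \<longleftrightarrow> (\<forall>j\<le>n. singular_chain j X (c j)) \<and> (\<exists>s. c 0 = frag_of s) \<and>
     (\<forall>j<n. even_chain (chain_boundary (Suc j) (c (Suc j)) - (c j + chain_map j f (c j))))"

lemma tower_singular_chain: "tower n X f c \<Longrightarrow> j \<le> n \<Longrightarrow> singular_chain j X (c j)"
  by (simp add: tower_def)

lemma tower_boundary:
  "tower n X f c \<Longrightarrow> j < n \<Longrightarrow>
     even_chain (chain_boundary (Suc j) (c (Suc j)) - (c j + chain_map j f (c j)))"
  by (simp add: tower_def)

text \<open>Over two elements \<open>(1 + f)\<^sup>2 = 1 + f\<^sup>2 = 2 = 0\<close>. This is the reason why towers can be
extended as long as cycles bound, and why the sum at the top of a tower is a cycle.\<close>

lemma tower_sum_mod2_cycle: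
  assumes c: "tower n X f c" and j: "j \<le> n"
    and f: "continuous_map X X f" "\<And>x. x \<in> topspace X \<Longrightarrow> f (f x) = x"
  shows "even_chain (chain_boundary j (c j + chain_map j f (c j)))"
proof (cases j)
  case 0
  then show ?thesis by (simp add: chain_boundary_def)
next
  case (Suc i)
  let ?d = "c i + chain_map i f (c i)"
  let ?e = "chain_boundary j (c j) - ?d"
  have ci: "singular_chain i X (c i)" and cj: "singular_chain j X (c j)"
    using c j Suc by (auto simp: tower_def)
  have ev: "even_chain ?e"
    using c j Suc by (simp add: tower_def)
  have "chain_map i f ?d = ?d"
    using chain_map_involution [OF ci f(2)] by (simp add: chain_map_add add.commute)
  then have "chain_boundary j (c j + chain_map j f (c j)) = ?e + chain_map i f ?e + (?d + ?d)"
    using chain_boundary_chain_map [OF cj, of f] Suc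
    by (simp add: chain_boundary_add chain_map_diff)
  moreover have "even_chain (?e + chain_map i f ?e + (?d + ?d))"
    by (intro even_chain_add even_chain_chain_map even_chain_double ev)
  ultimately show ?thesis
    by metis
qed

lemma tower_exists:
  assumes X: "acyclic_below n X" "topspace X \<noteq> {}"
    and f: "continuous_map X X f" "\<And>x. x \<in> topspace X \<Longrightarrow> f (f x) = x"
  shows "\<exists>c. tower n X f c"
proof -
  have "\<exists>c. tower k X f c" if "k \<le> n" for k
    using that
  proof (induction k)
    case 0
    obtain x where x: "x \<in> topspace X" using X(2) by blast
    have "singular_simplex 0 X (restrict (\<lambda>_. x) (standard_simplex 0))"
      using x by (simp add: singular_simplex_def)
    then show ?case
      by (intro exI [of _ "\<lambda>_. frag_of (restrict (\<lambda>_. x) (standard_simplex 0))"])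
        (auto simp: tower_def singular_chain_of)
  next
    case (Suc k)
    then obtain c where c: "tower k X f c" by auto
    let ?d = "c k + chain_map k f (c k)"
    have ck: "singular_chain k X (c k)"
      using c by (simp add: tower_def)
    have "bounds_mod2 k X ?d"
    proof (cases "k = 0")
      case True
      obtain s where s: "c 0 = frag_of s" using c by (auto simp: tower_def)
      have "singular_simplex 0 X s"
        using ck s True by (simp add: singular_chain_of)
      then show ?thesis
        using bounds_mod2_two_points [of X s "simplex_map 0 f s"] X s True f
        by (simp add: acyclic_below_def singular_simplex_simplex_map)
    next
      case False
      have "singular_chain k X ?d"
        using ck f by (blast intro: singular_chain_add singular_chain_chain_map)
      then show ?thesis
        using bounds_mod2_if_acyclic [OF X(1)] tower_sum_mod2_cycle [OF c _ f] Suc.prems False by auto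
    qed
    then obtain v where v: "singular_chain (Suc k) X v" "even_chain (?d - chain_boundary (Suc k) v)"
      unfolding bounds_mod2_def by blast
    have "even_chain (chain_boundary (Suc k) v - ?d)"
      using v(2) even_chain_minus_iff [of "?d - chain_boundary (Suc k) v"] by simp
    then have "tower (Suc k) X f (c(Suc k := v))"
      using c v(1) by (auto simp: tower_def le_Suc_eq less_Suc_eq)
    then show ?case by blast
  qed
  then show ?thesis by simp
qed

text \<open>Naturality for equivariant maps. It transports the comparison of top classes from one involution to another.\<close>

lemma tower_image:
  assumes c: "tower n X f c" and h: "continuous_map X Y h"
    and eq: "\<And>x. x \<in> topspace X \<Longrightarrow> h (f x) = g (h x)"
  shows "tower n Y g (\<lambda>j. chain_map j h (c j))"
  unfolding tower_def
proof (intro conjI allI impI)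
  show "singular_chain j Y (chain_map j h (c j))" if "j \<le> n" for j
    using singular_chain_chain_map [OF tower_singular_chain [OF c that] h] .
  show "\<exists>s. chain_map 0 h (c 0) = frag_of s"
    using c by (auto simp: tower_def)
next
  fix j assume j: "j < n"
  have cj: "singular_chain j X (c j)" and cs: "singular_chain (Suc j) X (c (Suc j))"
    using c j by (auto simp: tower_def)
  have "chain_map j h (chain_map j f (c j)) = chain_map j g (chain_map j h (c j))"
    using chain_map_eq [OF cj, of "h \<circ> f" "g \<circ> h"] eq by (simp add: chain_map_compose)
  then have "chain_map j h (chain_boundary (Suc j) (c (Suc j)) - (c j + chain_map j f (c j)))
     = chain_boundary (Suc j) (chain_map (Suc j) h (c (Suc j)))
        - (chain_map j h (c j) + chain_map j g (chain_map j h (c j)))"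
    using chain_boundary_chain_map [OF cs, of h] by (simp add: chain_map_diff chain_map_add)
  then show "even_chain (chain_boundary (Suc j) (chain_map (Suc j) h (c (Suc j)))
        - (chain_map j h (c j) + chain_map j g (chain_map j h (c j))))"
    using even_chain_chain_map [OF tower_boundary [OF c j], of j h] by simp
qed

section \<open>Spheres\<close>

definition antipode :: "(nat \<Rightarrow> real) \<Rightarrow> nat \<Rightarrow> real" where
  "antipode x = (\<lambda>i. - x i)"

lemma antipode_antipode [simp]: "antipode (antipode x) = x"
  by (simp add: antipode_def)

lemma antipode_apply: "antipode x i = - x i"
  by (simp add: antipode_def)

lemma topspace_nsphere: "topspace (nsphere n) = {x. (\<Sum>i\<le>n. (x i)\<^sup>2) = 1 \<and> (\<forall>i>n. x i = 0)}"
  by (auto simp: nsphere)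

lemma continuous_map_into_nsphere:
  "continuous_map X (nsphere n) f \<longleftrightarrow>
     (\<forall>i. continuous_map X euclideanreal (\<lambda>x. f x i)) \<and> f \<in> topspace X \<rightarrow> topspace (nsphere n)"
  unfolding nsphere continuous_map_in_subtopology
  by (auto simp: continuous_map_componentwise_UNIV)

lemma antipode_in_nsphere_iff [simp]: "antipode x \<in> topspace (nsphere n) \<longleftrightarrow> x \<in> topspace (nsphere n)"
  by (auto simp: topspace_nsphere antipode_apply)

lemma continuous_map_antipode: "continuous_map (nsphere n) (nsphere n) antipode"
  unfolding continuous_map_into_nsphere
  by (auto simp: antipode_apply intro!: continuous_intros continuous_map_nsphere_projection)

lemma path_connected_nsphere:
  assumes "0 < n"
  shows "path_connected_space (nsphere n)"
proof -
  let ?e = "\<lambda>i. if i = 0 then 1 else (0::real)"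
  let ?U = "topspace (nsphere n) \<inter> {x. 0 \<le> x n}" and ?L = "topspace (nsphere n) \<inter> {x. x n \<le> 0}"
  have "path_connectedin (nsphere n) ?U" "path_connectedin (nsphere n) ?L"
    using contractible_imp_path_connected_space [OF contractible_space_upper_hemisphere [of n n]]
      contractible_imp_path_connected_space [OF contractible_space_lower_hemisphere [of n n]]
    unfolding path_connectedin_def subtopology_restrict by simp_all
  moreover have "?e \<in> ?U \<inter> ?L"
    using in_topspace_nsphere [of n] assms by auto
  ultimately have "path_connectedin (nsphere n) (?U \<union> ?L)"
    by (intro path_connectedin_Un) auto
  moreover have "?U \<union> ?L = topspace (nsphere n)"
    by auto
  ultimately show ?thesis
    by (simp add: path_connectedin_topspace)
qed

lemma acyclic_below_nsphere:
  assumes "0 < n"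
  shows "acyclic_below n (nsphere n)"
  unfolding acyclic_below_def
proof (intro conjI allI impI)
  show "path_connected_space (nsphere n)"
    using assms by (rule path_connected_nsphere)
next
  fix p c
  assume p: "0 < p" "p < n" and c: "singular_relcycle p (nsphere n) {} c"
  have "trivial_group (homology_group (int p) (nsphere n))"
    using reduced_homology_group_nsphere(2) [of "int p" n] p by (simp add: un_reduced_homology_group)
  then show "singular_relboundary p (nsphere n) {} c"
    using c relboundary_of_trivial_homology by blast
qed

text \<open>The antipodal map has degree \<open>1\<close> or \<open>-1\<close>, so \<open>z\<close> plus its image is homologous to \<open>2z\<close> or to \<open>0\<close>.\<close>

lemma antipode_cycle_sum_bounds_mod2:
  assumes "0 < n" and z: "singular_relcycle n (nsphere n) {} z"
  shows "bounds_mod2 n (nsphere n) (z + chain_map n antipode z)"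
proof -
  let ?X = "nsphere n" and ?d = "Brouwer_degree2 n antipode"
  let ?G = "homology_group (int n) ?X"
  interpret group ?G by simp
  have G: "reduced_homology_group (int n) ?X = ?G"
    using assms(1) by (simp add: un_reduced_homology_group)
  have zG: "homologous_rel_set n ?X {} z \<in> carrier ?G"
    using z by (auto simp: carrier_relative_homology_group)
  have "homeomorphic_map ?X ?X antipode"
    unfolding homeomorphic_map_maps homeomorphic_maps_def
    using continuous_map_antipode by (intro exI [of _ antipode]) auto
  then have "?d = 1 \<or> ?d = -1"
    using Brouwer_degree2_homeomorphic_map [of n antipode] by arith
  moreover have eq: "homologous_rel_set n ?X {} (chain_map n antipode z)
        = homologous_rel_set n ?X {} z [^]\<^bsub>?G\<^esub> ?d"
    using Brouwer_degree2 [of "homologous_rel_set n ?X {} z" n antipode] zG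
      hom_induced_chain_map [OF continuous_map_antipode _ z, of "{}"] by (simp add: G)
  ultimately consider "homologous_rel n ?X {} (chain_map n antipode z) z"
    | "homologous_rel n ?X {} (chain_map n antipode z) (- z)"
  proof (elim disjE)
    assume "?d = 1"
    with eq zG that(1) show ?thesis
      by (simp add: homologous_rel_set_eq int_pow_1)
  next
    assume d: "?d = -1"
    have "homologous_rel_set n ?X {} (chain_map n antipode z) = uminus ` homologous_rel_set n ?X {} z"
      using eq zG inv_relative_homology_group [OF zG] by (simp add: d int_pow_neg int_pow_1)
    moreover have "- z \<in> uminus ` homologous_rel_set n ?X {} z"
      by simp
    ultimately have "- z \<in> homologous_rel_set n ?X {} (chain_map n antipode z)"
      by simp
    with that(2) show ?thesis by simp
  qed
  then show ?thesis
  proof cases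
    case 1
    then have "bounds_mod2 n ?X (chain_map n antipode z - z)"
      unfolding homologous_rel_def by (rule bounds_mod2_relboundary)
    then show ?thesis
      by (rule bounds_mod2_even_diff) (simp add: algebra_simps)
  next
    case 2
    then show ?thesis
      using bounds_mod2_relboundary [of n ?X "chain_map n antipode z - - z"]
      by (simp add: homologous_rel_def add.commute)
  qed
qed

section \<open>The hemispherical tower\<close>

abbreviation upper_hemisphere :: "nat \<Rightarrow> (nat \<Rightarrow> real) topology" where
  "upper_hemisphere n \<equiv> subtopology (nsphere n) {x. 0 \<le> x n}"

lemma contractible_upper_hemisphere: "contractible_space (upper_hemisphere n)"
  by (simp add: contractible_space_upper_hemisphere)

lemma equator_eq_nsphere:
  "subtopology (upper_hemisphere (Suc n)) {x. x (Suc n) = 0} = nsphere n"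
proof -
  have "{x. 0 \<le> x (Suc n)} \<inter> {x. x (Suc n) = 0} = {x. x (Suc n) = (0::real)}"
    by auto
  then show ?thesis
    by (simp add: subtopology_subtopology subtopology_nsphere_equator)
qed

lemma continuous_map_nsphere_upper_hemisphere:
  "continuous_map (nsphere n) (upper_hemisphere (Suc n)) id"
  using continuous_map_from_subtopology [OF continuous_map_id, of "upper_hemisphere (Suc n)" "{x. x (Suc n) = 0}"]
  by (simp add: equator_eq_nsphere)

lemma singular_chain_inclusion:
  "singular_chain p X c \<Longrightarrow> continuous_map X Y id \<Longrightarrow> singular_chain p Y c"
  by (metis chain_map_ident singular_chain_chain_map)

text \<open>The next two lemmas express on chains that an inclusion of pairs is injective and surjective on
relative homology.\<close>

lemma iso_inclusion_relboundary:
  assumes iso: "hom_induced (int p) X S Y T id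
      \<in> iso (relative_homology_group (int p) X S) (relative_homology_group (int p) Y T)"
    and sub: "continuous_map X Y id" "S \<subseteq> T"
    and c: "singular_relcycle p X S c" "singular_relboundary p Y T c"
  shows "singular_relboundary p X S c"
proof -
  let ?G = "relative_homology_group (int p) X S" and ?H = "relative_homology_group (int p) Y T"
  let ?h = "hom_induced (int p) X S Y T id"
  interpret group_hom ?G ?H ?h
    using iso by (simp add: group_hom_def group_hom_axioms_def iso_def)
  have idT: "id \<in> S \<rightarrow> T"
    using sub(2) by auto
  have cp: "chain_map p id c = c"
    using c(1) chain_map_ident unfolding singular_relcycle by blast
  have "?h (homologous_rel_set p X S c) = homologous_rel_set p Y T c"
    using hom_induced_chain_map [OF sub(1) _ c(1), of T] idT cp by simp
  also have "\<dots> = \<one>\<^bsub>?H\<^esub>"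
    using c(2) by (simp add: homologous_rel_set_eq_relboundary)
  also have "\<dots> = ?h \<one>\<^bsub>?G\<^esub>"
    by (rule hom_one [symmetric])
  finally have eq: "?h (homologous_rel_set p X S c) = ?h \<one>\<^bsub>?G\<^esub>" .
  have "inj_on ?h (carrier ?G)"
    using iso by (simp add: iso_def bij_betw_def)
  moreover have "homologous_rel_set p X S c \<in> carrier ?G"
    using c(1) by (auto simp: carrier_relative_homology_group)
  ultimately have "homologous_rel_set p X S c = \<one>\<^bsub>?G\<^esub>"
    using eq by (meson G.one_closed inj_onD)
  then show ?thesis
    by (simp add: homologous_rel_set_eq_relboundary)
qed

lemma iso_inclusion_relcycle:
  assumes iso: "hom_induced (int p) X S Y T id
      \<in> iso (relative_homology_group (int p) X S) (relative_homology_group (int p) Y T)"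
    and sub: "continuous_map X Y id" "S \<subseteq> T"
    and w: "singular_relcycle p Y T w"
  obtains w' where "singular_relcycle p X S w'" "homologous_rel p Y T w w'"
proof -
  let ?h = "hom_induced (int p) X S Y T id"
  have "homologous_rel_set p Y T w \<in> ?h ` carrier (relative_homology_group (int p) X S)"
    using iso w unfolding iso_def bij_betw_def by (auto simp: carrier_relative_homology_group)
  then obtain w' where w': "singular_relcycle p X S w'"
      "homologous_rel_set p Y T w = ?h (homologous_rel_set p X S w')"
    by (auto simp: carrier_relative_homology_group)
  have idT: "id \<in> S \<rightarrow> T"
    using sub(2) by auto
  have "chain_map p id w' = w'"
    using w'(1) chain_map_ident unfolding singular_relcycle by blast
  then have "homologous_rel_set p Y T w = homologous_rel_set p Y T w'"
    using w' hom_induced_chain_map [OF sub(1) _ w'(1), of T] idT by simp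
  then show thesis
    using that w'(1) by (simp add: homologous_rel_set_eq)
qed

text \<open>Here the tower is built with integral chains and exact signs, because its top cycle has to be followed
through the integral excision isomorphism. The sign makes consecutive operators compose to zero:
\<open>(1 + e a) (1 - e a) = 1 - a\<^sup>2 = 0\<close> for \<open>e\<close> equal to \<open>1\<close> or \<open>-1\<close> and \<open>a\<close> the antipodal map. Each chain exists since the cycle
to be bounded lies in the boundary sphere of a contractible hemisphere.\<close>

lemma hemispherical_tower_exists:
  obtains c where "\<And>j. singular_chain j (upper_hemisphere j) (c j)"
    and "\<exists>s. c 0 = frag_of s"
    and "\<And>j. chain_boundary (Suc j) (c (Suc j)) = c j + frag_cmul ((-1) ^ Suc j) (chain_map j antipode (c j))"
proof -
  define Z where "Z \<equiv> \<lambda>j (c :: (nat \<Rightarrow> real) chain). c + frag_cmul ((-1) ^ Suc j) (chain_map j antipode c)"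
  have Z: "Z j c = c + frag_cmul ((-1) ^ Suc j) (chain_map j antipode c)" for j c
    by (simp add: Z_def)
  define P where "P \<equiv> \<lambda>j c. singular_chain j (upper_hemisphere j) c \<and> (j = 0 \<longrightarrow> (\<exists>s. c = frag_of s))
      \<and> chain_boundary j (Z j c) = 0"
  have "\<exists>c. \<forall>j. P j (c j) \<and> chain_boundary (Suc j) (c (Suc j)) = Z j (c j)"
  proof (rule dependent_nat_choice)
    let ?e = "\<lambda>i. if i = 0 then 1 else (0::real)"
    have "singular_simplex 0 (upper_hemisphere 0) (restrict (\<lambda>_. ?e) (standard_simplex 0))"
      using in_topspace_nsphere [of 0] by (simp add: singular_simplex_def)
    then show "\<exists>c. P 0 c"
      unfolding P_def
      by (intro exI [of _ "frag_of (restrict (\<lambda>_. ?e) (standard_simplex 0))"])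
        (auto simp: singular_chain_of chain_boundary_def)
  next
    fix c j assume Pc: "P j c"
    have cj: "singular_chain j (nsphere j) c"
      using Pc by (auto simp: P_def intro: singular_chain_inclusion)
    then have Zs: "singular_chain j (nsphere j) (Z j c)"
      unfolding Z_def
      by (intro singular_chain_add singular_chain_cmul singular_chain_chain_map [OF _ continuous_map_antipode])
    then have ZU: "singular_chain j (upper_hemisphere (Suc j)) (Z j c)"
      by (rule singular_chain_inclusion [OF _ continuous_map_nsphere_upper_hemisphere])
    have ac: "acyclic_below (Suc j) (upper_hemisphere (Suc j))"
      by (rule acyclic_below_contractible [OF contractible_upper_hemisphere])
    have "singular_relboundary j (upper_hemisphere (Suc j)) {} (Z j c)"
    proof (cases "j = 0")
      case True
      then obtain s where s: "c = frag_of s" using Pc by (auto simp: P_def)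
      have c0: "singular_chain 0 (nsphere 0) c"
        using cj True by simp
      then have "singular_chain 0 (nsphere 0) (chain_map 0 antipode c)"
        by (rule singular_chain_chain_map [OF _ continuous_map_antipode])
      then have "singular_chain 0 (upper_hemisphere 1) c"
        "singular_chain 0 (upper_hemisphere 1) (chain_map 0 antipode c)"
        using singular_chain_inclusion [OF _ continuous_map_nsphere_upper_hemisphere [of 0]] c0 by simp_all
      then have "homologous_rel 0 (upper_hemisphere 1) {} (frag_of s) (frag_of (simplex_map 0 antipode s))"
        using ac s True
        by (intro iso_integer_zeroth_homology_group_aux) (auto simp: acyclic_below_def singular_chain_of)
      then show ?thesis
        using True by (simp add: Z_def s homologous_rel_def)
    next
      case False
      then show ?thesis
        using ac ZU Pc by (auto simp: acyclic_below_def P_def singular_cycle)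
    qed
    then obtain d where d: "singular_chain (Suc j) (upper_hemisphere (Suc j)) d"
        "chain_boundary (Suc j) d = Z j c"
      unfolding singular_boundary by blast
    have "chain_boundary (Suc j) (Z (Suc j) d) = Z j c - frag_cmul ((-1) ^ Suc j) (chain_map j antipode (Z j c))"
      using chain_boundary_chain_map [OF d(1), of antipode] d(2)
      by (simp add: Z [of "Suc j"] chain_boundary_add chain_boundary_cmul chain_boundary_minus chain_boundary_diff)
    also have "\<dots> = 0"
      using chain_map_involution [OF cj, of antipode]
      by (simp add: Z chain_map_add chain_map_minus chain_map_diff frag_cmul_distrib2 flip: power_mult_distrib)
    finally have "P (Suc j) d"
      using d(1) by (simp add: P_def)
    then show "\<exists>d. P (Suc j) d \<and> chain_boundary (Suc j) d = Z j c"
      using d(2) by blast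
  qed
  then show thesis
    using that unfolding P_def Z_def by blast
qed

text \<open>The 0-sphere is discrete, so every singular 1-simplex in it is constant.\<close>

lemma boundary_1_chain_nsphere_0:
  assumes "singular_chain (Suc 0) (nsphere 0) v"
  shows "chain_boundary (Suc 0) v = 0"
  using assms unfolding singular_chain_def
proof (induction v rule: frag_induction)
  case (one s)
  let ?D = "standard_simplex (Suc 0)"
  have cs: "continuous_map (subtopology (powertop_real UNIV) ?D) (nsphere 0) s"
    using one by (simp add: singular_simplex_def)
  have cs0: "continuous_map (subtopology (powertop_real UNIV) ?D) euclideanreal (\<lambda>x. s x 0)"
    using continuous_map_compose [OF cs continuous_map_nsphere_projection] by (simp add: o_def)
  have top: "s x \<in> topspace (nsphere 0)" if "x \<in> ?D" for x
    using continuous_map_funspace [OF cs] that by auto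
  then have vals: "s x 0 \<in> {1, -1}" if "x \<in> ?D" for x
    using that by (force simp: topspace_nsphere power2_eq_1_iff)
  have "connectedin euclideanreal ((\<lambda>x. s x 0) ` ?D)"
    using connectedin_standard_simplex [of "Suc 0"]
    by (intro connectedin_continuous_map_image [OF cs0]) (simp add: connectedin_subtopology)
  then have "connected ((\<lambda>x. s x 0) ` ?D)"
    by simp
  moreover have "finite ((\<lambda>x. s x 0) ` ?D)"
    by (rule finite_subset [OF image_subsetI [OF vals]]) simp_all
  ultimately have sing: "(\<lambda>x. s x 0) ` ?D = {} \<or> (\<exists>a. (\<lambda>x. s x 0) ` ?D = {a})"
    by (simp only: connected_finite_iff_sing)
  have const: "s x 0 = s y 0" if "x \<in> ?D" "y \<in> ?D" for x y
    using sing imageI [OF that(1), of "\<lambda>x. s x 0"] imageI [OF that(2), of "\<lambda>x. s x 0"]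
    by (metis empty_iff singletonD)
  have "s x = s y" if "x \<in> ?D" "y \<in> ?D" for x y
  proof
    fix i show "s x i = s y i"
      using const [OF that] top that by (cases i) (auto simp: topspace_nsphere)
  qed
  then have "singular_face (Suc 0) 0 s = singular_face (Suc 0) (Suc 0) s"
    unfolding singular_face_def
    by (intro restrict_ext) (auto simp: simplical_face_in_standard_simplex)
  then show ?case
    by (simp add: chain_boundary_of)
qed (auto simp: chain_boundary_diff)

lemma frag_cmul_uminus: "frag_cmul (- k) c = - frag_cmul k c"
  using frag_cmul_cmul [of "-1" k c] by simp

text \<open>The two hemispheres glued along the equator form a class that is not divisible by two. The proof is by
induction on the dimension. Modulo the lower hemisphere only the upper hemisphere \<open>c\<close> is left of this class; by excision
a relation \<open>c = 2w\<close> can be moved into the upper hemisphere modulo the equator, and its boundary is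
the same relation one dimension lower. On the 0-sphere the class is a difference of
two distinct points.\<close>

lemma hemispherical_class_not_divisible:
  assumes c: "\<And>j. singular_chain j (upper_hemisphere j) (c j)"
    and c0: "c 0 = frag_of s"
    and bd: "\<And>j. chain_boundary (Suc j) (c (Suc j)) = c j + frag_cmul ((-1) ^ Suc j) (chain_map j antipode (c j))"
    and v: "singular_chain (Suc n) (nsphere n) v"
    and w: "singular_chain n (nsphere n) w"
  shows "c n + frag_cmul ((-1) ^ Suc n) (chain_map n antipode (c n)) \<noteq> chain_boundary (Suc n) v + (w + w)"
  using v w
proof (induction n arbitrary: v w)
  case 0
  let ?t = "simplex_map 0 antipode s"
  have s: "singular_simplex 0 (upper_hemisphere 0) s"
    using c [of 0] c0 by (simp add: singular_chain_of)
  let ?p = "\<lambda>j::nat. if j = 0 then 1 else (0::real)"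
  have "s ?p \<in> topspace (upper_hemisphere 0)"
    using continuous_map_funspace [of "subtopology (powertop_real UNIV) (standard_simplex 0)" "upper_hemisphere 0" s] s
    by (auto simp: singular_simplex_def standard_simplex_0)
  then have "s ?p 0 = 1"
    by (auto simp: topspace_nsphere power2_eq_1_iff)
  moreover have "?t ?p = antipode (s ?p)"
    by (simp add: simplex_map_def standard_simplex_0)
  ultimately have "?t ?p 0 \<noteq> s ?p 0"
    by (simp add: antipode_apply)
  then have "?t \<noteq> s" by metis
  show ?case
  proof
    assume "c 0 + frag_cmul ((-1) ^ Suc 0) (chain_map 0 antipode (c 0)) = chain_boundary (Suc 0) v + (w + w)"
    then have "frag_of s - frag_of ?t = w + w"
      using boundary_1_chain_nsphere_0 [OF "0.prems"(1)] by (simp add: c0)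
    then have "Poly_Mapping.lookup (frag_of s - frag_of ?t) s = Poly_Mapping.lookup (w + w) s"
      by simp
    then have "1 = 2 * Poly_Mapping.lookup w s"
      using \<open>?t \<noteq> s\<close> by (simp add: lookup_minus lookup_add)
    then show False by presburger
  qed
next
  case (Suc n)
  let ?S = "nsphere (Suc n)" and ?U = "upper_hemisphere (Suc n)"
  let ?L = "{x. x (Suc n) \<le> (0::real)}" and ?E = "{x. x (Suc n) = (0::real)}"
  let ?m = "Suc n"
  define ac where "ac = frag_cmul ((-1) ^ Suc ?m) (chain_map ?m antipode (c ?m))"
  have iso: "hom_induced (int ?m) ?U ?E ?S ?L id
      \<in> iso (relative_homology_group (int ?m) ?U ?E) (relative_homology_group (int ?m) ?S ?L)"
    by (rule iso_relative_homology_group_upper_hemisphere)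
  have sub: "continuous_map ?U ?S id" "?E \<subseteq> ?L"
    by (auto intro: continuous_map_from_subtopology)
  have E: "subtopology ?U ?E = nsphere n"
    by (rule equator_eq_nsphere)
  have cm: "singular_chain ?m ?U (c ?m)" by (rule c)
  have cn: "singular_chain n (nsphere n) (c n)"
    using c [of n] by (rule singular_chain_inclusion) (auto intro: continuous_map_from_subtopology)
  have an: "singular_chain n (nsphere n) (chain_map n antipode (c n))"
    by (rule singular_chain_chain_map [OF cn continuous_map_antipode])
  have cyc: "singular_relcycle ?m ?U ?E (c ?m)"
    unfolding singular_relcycle using cm bd [of n] cn an
    by (simp add: E singular_chain_add singular_chain_minus singular_chain_cmul)
  have "continuous_map ?U (subtopology ?S ?L) antipode"
    by (auto simp: continuous_map_in_subtopology antipode_apply intro: continuous_map_from_subtopology continuous_map_antipode)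
  then have ac: "singular_chain ?m (subtopology ?S ?L) ac"
    unfolding ac_def by (intro singular_chain_cmul singular_chain_chain_map [OF cm])
  show ?case
  proof
    assume eq: "c ?m + frag_cmul ((-1) ^ Suc ?m) (chain_map ?m antipode (c ?m))
        = chain_boundary (Suc ?m) v + (w + w)"
    then have ceq: "c ?m = chain_boundary (Suc ?m) v + (w + w) - ac"
      by (simp add: ac_def algebra_simps)
    have "chain_boundary ?m (c ?m + ac) = 0"
    proof -
      have "chain_boundary ?m (chain_map ?m antipode (c ?m))
          = chain_map n antipode (chain_boundary ?m (c ?m))"
        using chain_boundary_chain_map [OF cm, of antipode] by simp
      also have "\<dots> = chain_map n antipode (c n) + frag_cmul ((-1) ^ Suc n) (c n)"
        using chain_map_involution [OF cn, of antipode] by (simp only: bd chain_map_add chain_map_cmul) simp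
      finally have "chain_boundary ?m ac
          = frag_cmul ((-1) ^ Suc ?m) (chain_map n antipode (c n)) + frag_cmul ((-1) ^ Suc ?m * (-1) ^ Suc n) (c n)"
        by (simp only: ac_def chain_boundary_cmul frag_cmul_distrib2 frag_cmul_cmul)
      moreover have "(-1) ^ Suc ?m * (-1) ^ Suc n = (-1::int)"
        by simp
      moreover have "frag_cmul ((-1) ^ Suc ?m) d = - frag_cmul ((-1) ^ Suc n) d" for d :: "(nat \<Rightarrow> real) chain"
        by (metis frag_cmul_uminus mult_minus1 power_Suc)
      ultimately have "chain_boundary ?m ac = - (frag_cmul ((-1) ^ Suc n) (chain_map n antipode (c n)) + c n)"
        by (metis frag_cmul_minus_one minus_add_distrib)
      then show ?thesis
        by (simp only: chain_boundary_add bd [of n]) (metis add.commute add.right_inverse)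
    qed
    then have "chain_boundary ?m w + chain_boundary ?m w = 0"
      using chain_boundary_boundary [OF Suc.prems(1)]
      by (simp add: ceq chain_boundary_add)
    then have "singular_relcycle ?m ?S ?L w"
      using Suc.prems(2) by (simp add: singular_relcycle frag_double_eq_0)
    then obtain w' where w': "singular_relcycle ?m ?U ?E w'" "homologous_rel ?m ?S ?L w w'"
      by (rule iso_inclusion_relcycle [OF iso sub])
    \<comment> \<open>The relation \<open>c = 2w\<close> modulo the lower hemisphere, with \<open>w\<close> replaced by its excised form.\<close>
    have "singular_relboundary ?m ?S ?L (chain_boundary (Suc ?m) v + ((w - w') + (w - w')) - ac)"
    proof -
      have "singular_relboundary ?m ?S ?L (chain_boundary (Suc ?m) v)"
        unfolding singular_relboundary using Suc.prems(1) by (metis add_0_right singular_chain_0)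
      moreover have "singular_relboundary ?m ?S ?L (w - w')"
        using w'(2) by (simp add: homologous_rel_def)
      moreover have "singular_relboundary ?m ?S ?L ac"
        using ac by (rule singular_chain_imp_relboundary)
      ultimately show ?thesis
        by (blast intro: singular_relboundary_diff singular_relboundary_add)
    qed
    also have "chain_boundary (Suc ?m) v + ((w - w') + (w - w')) - ac = c ?m - (w' + w')"
      by (simp add: ceq)
    finally have "singular_relboundary ?m ?U ?E (c ?m - (w' + w'))"
      by (intro iso_inclusion_relboundary [OF iso sub] singular_relcycle_diff singular_relcycle_add cyc w'(1))
    then obtain d e where d: "singular_chain (Suc ?m) ?U d" and e: "singular_chain ?m (nsphere n) e"
      and de: "chain_boundary (Suc ?m) d + e = c ?m - (w' + w')"
      unfolding singular_relboundary E by blast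
    have "chain_boundary ?m (c ?m) - (chain_boundary ?m w' + chain_boundary ?m w') = chain_boundary ?m e"
      using arg_cong [OF de, of "chain_boundary ?m"] chain_boundary_boundary [OF d]
      by (simp add: chain_boundary_add chain_boundary_diff)
    then have "c n + frag_cmul ((-1) ^ Suc n) (chain_map n antipode (c n))
        = chain_boundary (Suc n) e + (chain_boundary ?m w' + chain_boundary ?m w')"
      by (simp add: bd algebra_simps)
    moreover have "singular_chain n (nsphere n) (chain_boundary ?m w')"
      using w'(1) by (simp add: singular_relcycle E)
    ultimately show False
      using Suc.IH [OF e] by blast
  qed
qed

lemma continuous_map_nsphere_le: "m \<le> n \<Longrightarrow> continuous_map (nsphere m) (nsphere n) id"
proof (induction n rule: dec_induct)
  case (step n)
  have "continuous_map (nsphere n) (nsphere (Suc n)) id"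
    using continuous_map_nsphere_upper_hemisphere [of n] by (simp add: continuous_map_in_subtopology)
  then show ?case
    using continuous_map_compose [OF step.IH] by (metis comp_id)
qed simp

text \<open>Modulo two the signs of the hemispherical tower disappear.\<close>

lemma essential_tower_nsphere:
  obtains c where "tower n (nsphere n) antipode c"
    "\<not> bounds_mod2 n (nsphere n) (c n + chain_map n antipode (c n))"
proof -
  obtain c where c: "\<And>j. singular_chain j (upper_hemisphere j) (c j)"
    and c0: "\<exists>s. c 0 = frag_of s"
    and bd: "\<And>j. chain_boundary (Suc j) (c (Suc j)) = c j + frag_cmul ((-1) ^ Suc j) (chain_map j antipode (c j))"
    using hemispherical_tower_exists by blast
  have sign: "even_chain (frag_cmul ((-1) ^ k) d - d)" for k and d :: "(nat \<Rightarrow> real) chain"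
  proof (cases "even k")
    case False
    have "- d - d = (- d) + (- d)" by simp
    with False show ?thesis by (metis even_chain_double frag_cmul_minus_one uminus_power_if power_one)
  qed simp
  have cn: "singular_chain j (nsphere n) (c j)" if "j \<le> n" for j
  proof (rule singular_chain_inclusion [OF c])
    show "continuous_map (upper_hemisphere j) (nsphere n) id"
      by (intro continuous_map_from_subtopology continuous_map_nsphere_le that)
  qed
  have t: "tower n (nsphere n) antipode c"
    unfolding tower_def
  proof (intro conjI allI impI)
    show "singular_chain j (nsphere n) (c j)" if "j \<le> n" for j
      by (rule cn [OF that])
    show "\<exists>s. c 0 = frag_of s" by (rule c0)
    show "even_chain (chain_boundary (Suc j) (c (Suc j)) - (c j + chain_map j antipode (c j)))" for j
      using sign [of "Suc j" "chain_map j antipode (c j)"] by (simp only: bd add_diff_add diff_self add_0)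
  qed
  moreover have "\<not> bounds_mod2 n (nsphere n) (c n + chain_map n antipode (c n))"
  proof
    let ?z = "c n + frag_cmul ((-1) ^ Suc n) (chain_map n antipode (c n))"
    assume "bounds_mod2 n (nsphere n) (c n + chain_map n antipode (c n))"
    moreover have "even_chain (?z - (c n + chain_map n antipode (c n)))"
      using sign [of "Suc n" "chain_map n antipode (c n)"] by (simp only: add_diff_add diff_self add_0)
    ultimately have "bounds_mod2 n (nsphere n) ?z"
      by (rule bounds_mod2_even_diff)
    then obtain v w where v: "singular_chain (Suc n) (nsphere n) v" and w: "?z - chain_boundary (Suc n) v = w + w"
      unfolding bounds_mod2_def even_chain_def by blast
    have "singular_chain n (nsphere n) (chain_map n antipode (c n))"
      by (rule singular_chain_chain_map [OF cn continuous_map_antipode]) simp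
    then have "singular_chain n (nsphere n) (w + w)"
      unfolding w [symmetric] using v cn
      by (intro singular_chain_diff singular_chain_add singular_chain_cmul singular_chain_boundary_alt) simp_all
    then have "singular_chain n (nsphere n) w"
      by (simp add: singular_chain_half)
    moreover have "?z = chain_boundary (Suc n) v + (w + w)"
      by (simp flip: w)
    moreover obtain s where "c 0 = frag_of s" using c0 by blast
    ultimately show False
      using hemispherical_class_not_divisible [OF c _ bd v] by blast
  qed
  ultimately show thesis by (rule that)
qed

section \<open>The top class of a tower\<close>

text \<open>In degree \<open>j\<close> the chain \<open>y\<close> is \<open>k\<close> times the reference tower \<open>c\<close>, up to even chains, boundaries, and sums
\<open>w + a w\<close>, where \<open>a\<close> is the antipodal map. In terms of projective space: the images of \<open>y\<close> and of \<open>k c\<^sub>j\<close> are homologous modulo two. Only the parity of \<open>k\<close>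
matters, but an integer can carry a binomial coefficient.\<close>

definition aligned :: "nat \<Rightarrow> (nat \<Rightarrow> (nat \<Rightarrow> real) chain) \<Rightarrow> nat \<Rightarrow> int \<Rightarrow> (nat \<Rightarrow> real) chain \<Rightarrow> bool" where
  "aligned n c j k y \<longleftrightarrow>
     (\<exists>v w. singular_chain (Suc j) (nsphere n) v \<and> singular_chain j (nsphere n) w \<and>
        even_chain (y - (frag_cmul k (c j) + chain_boundary (Suc j) v + (w + chain_map j antipode w))))"

text \<open>In the top degree \<open>n\<close> not every cycle bounds, and only this consequence of alignment survives; it is what
the degree arguments use.\<close>

definition aligned_top :: "nat \<Rightarrow> (nat \<Rightarrow> (nat \<Rightarrow> real) chain) \<Rightarrow> nat \<Rightarrow> int \<Rightarrow> (nat \<Rightarrow> real) chain \<Rightarrow> bool" where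
  "aligned_top n c j k y \<longleftrightarrow>
     bounds_mod2 j (nsphere n) (y + chain_map j antipode y - frag_cmul k (c j + chain_map j antipode (c j)))"

lemma aligned_0: "aligned n c j 0 0"
  unfolding aligned_def by (intro exI [of _ 0]) simp

lemma aligned_add:
  assumes "aligned n c j k y" "aligned n c j l z"
  shows "aligned n c j (k + l) (y + z)"
proof -
  obtain v w where 1: "singular_chain (Suc j) (nsphere n) v" "singular_chain j (nsphere n) w"
      "even_chain (y - (frag_cmul k (c j) + chain_boundary (Suc j) v + (w + chain_map j antipode w)))"
    using assms(1) unfolding aligned_def by blast
  obtain v' w' where 2: "singular_chain (Suc j) (nsphere n) v'" "singular_chain j (nsphere n) w'"
      "even_chain (z - (frag_cmul l (c j) + chain_boundary (Suc j) v' + (w' + chain_map j antipode w')))"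
    using assms(2) unfolding aligned_def by blast
  show ?thesis
    unfolding aligned_def
  proof (intro exI conjI)
    show "singular_chain (Suc j) (nsphere n) (v + v')" "singular_chain j (nsphere n) (w + w')"
      using 1 2 by (simp_all add: singular_chain_add)
    show "even_chain (y + z - (frag_cmul (k + l) (c j) + chain_boundary (Suc j) (v + v')
        + ((w + w') + chain_map j antipode (w + w'))))"
      using even_chain_add [OF 1(3) 2(3)]
      by (simp add: frag_cmul_distrib chain_boundary_add chain_map_add algebra_simps)
  qed
qed

lemma aligned_point:
  assumes n: "0 < n" and c: "tower n (nsphere n) antipode c" and s: "singular_simplex 0 (nsphere n) s"
  shows "aligned n c 0 1 (frag_of s)"
proof -
  obtain t where t: "c 0 = frag_of t" using c by (auto simp: tower_def)
  have "singular_simplex 0 (nsphere n) t"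
    using tower_singular_chain [OF c, of 0] by (simp add: t singular_chain_of)
  then have "bounds_mod2 0 (nsphere n) (frag_of s + frag_of t)"
    using bounds_mod2_two_points [OF path_connected_nsphere [OF n] s] by blast
  then obtain v where v: "singular_chain (Suc 0) (nsphere n) v"
      "even_chain (frag_of s + frag_of t - chain_boundary (Suc 0) v)"
    unfolding bounds_mod2_def by blast
  have "even_chain (frag_of s + frag_of t - chain_boundary (Suc 0) v - (frag_of t + frag_of t))"
    by (intro even_chain_diff v even_chain_double)
  then show ?thesis
    unfolding aligned_def using v(1)
    by (intro exI [of _ v] exI [of _ 0]) (simp add: t algebra_simps)
qed

text \<open>If the boundary of \<open>x\<close> is \<open>y + a y\<close> and \<open>y\<close> is \<open>k c\<^sub>j\<close> up to the boundary of \<open>v\<close>, then \<open>x\<close> is \<open>k\<close> times the next stage of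
the tower up to \<open>v + a v\<close> and a cycle. Below the top degree this cycle bounds; in the top
degree its sum with its antipodal image bounds. The next two lemmas draw these conclusions.\<close>

lemma aligned_step_cycle:
  assumes c: "tower n (nsphere n) antipode c" and j: "j < n"
    and al: "aligned n c j k y"
    and x: "singular_chain (Suc j) (nsphere n) x"
    and y: "even_chain (chain_boundary (Suc j) x - (y + chain_map j antipode y))"
  obtains v where "singular_chain (Suc j) (nsphere n) v"
    "even_chain (chain_boundary (Suc j) (x - frag_cmul k (c (Suc j)) - (v + chain_map (Suc j) antipode v)))"
proof -
  let ?a = "chain_map j antipode"
  obtain v w where v: "singular_chain (Suc j) (nsphere n) v" and w: "singular_chain j (nsphere n) w"
      and E3: "even_chain (y - (frag_cmul k (c j) + chain_boundary (Suc j) v + (w + ?a w)))"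
    using al unfolding aligned_def by blast
  define e3 where "e3 = y - (frag_cmul k (c j) + chain_boundary (Suc j) v + (w + ?a w))"
  define e2 where "e2 = chain_boundary (Suc j) (c (Suc j)) - (c j + ?a (c j))"
  define e1 where "e1 = chain_boundary (Suc j) x - (y + ?a y)"
  have bx: "chain_boundary (Suc j) x = e1 + (y + ?a y)"
    by (simp add: e1_def)
  have bc: "chain_boundary (Suc j) (c (Suc j)) = e2 + (c j + ?a (c j))"
    by (simp add: e2_def)
  have yy: "y = e3 + (frag_cmul k (c j) + chain_boundary (Suc j) v + (w + ?a w))"
    by (simp add: e3_def)
  have aa: "?a (?a w) = w"
    using chain_map_involution [OF w, of antipode] by simp
  have ay: "?a y = ?a e3 + (frag_cmul k (?a (c j)) + ?a (chain_boundary (Suc j) v) + (?a w + w))"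
    by (subst yy) (simp add: chain_map_add aa)
  have bav: "chain_boundary (Suc j) (chain_map (Suc j) antipode v) = ?a (chain_boundary (Suc j) v)"
    using chain_boundary_chain_map [OF v, of antipode] by simp
  have "chain_boundary (Suc j) (x - frag_cmul k (c (Suc j)) - (v + chain_map (Suc j) antipode v))
     = e1 - frag_cmul k e2 + e3 + ?a e3 + ((w + ?a w) + (w + ?a w))"
    unfolding chain_boundary_diff chain_boundary_add chain_boundary_cmul bav bx bc ay
    by (subst yy) (simp add: frag_cmul_distrib2 algebra_simps)
  moreover have "even_chain (e1 - frag_cmul k e2 + e3 + ?a e3 + ((w + ?a w) + (w + ?a w)))"
    using y E3 tower_boundary [OF c j] unfolding e1_def [symmetric] e2_def [symmetric] e3_def [symmetric]
    by (intro even_chain_add even_chain_diff even_chain_cmul even_chain_chain_map even_chain_double)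
  ultimately show thesis
    using that [OF v] by metis
qed

lemma aligned_step:
  assumes n: "0 < n" and c: "tower n (nsphere n) antipode c" and j: "Suc j < n"
    and al: "aligned n c j k y"
    and x: "singular_chain (Suc j) (nsphere n) x"
    and y: "even_chain (chain_boundary (Suc j) x - (y + chain_map j antipode y))"
  shows "aligned n c (Suc j) k x"
proof -
  let ?S = "nsphere n"
  obtain v where v: "singular_chain (Suc j) ?S v"
    and ev: "even_chain (chain_boundary (Suc j)
        (x - frag_cmul k (c (Suc j)) - (v + chain_map (Suc j) antipode v)))"
    using aligned_step_cycle [OF c _ al x y] j by auto
  let ?t = "x - frag_cmul k (c (Suc j)) - (v + chain_map (Suc j) antipode v)"
  have "singular_chain (Suc j) ?S ?t"
    using x v j tower_singular_chain [OF c, of "Suc j"]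
    by (intro singular_chain_diff singular_chain_add singular_chain_cmul
        singular_chain_chain_map [OF _ continuous_map_antipode]) auto
  then have "bounds_mod2 (Suc j) ?S ?t"
    using bounds_mod2_if_acyclic [OF acyclic_below_nsphere [OF n]] ev j by blast
  then obtain u where u: "singular_chain (Suc (Suc j)) ?S u"
      "even_chain (?t - chain_boundary (Suc (Suc j)) u)"
    unfolding bounds_mod2_def by blast
  then show ?thesis
    unfolding aligned_def using v
    by (intro exI [of _ u] exI [of _ v]) (simp add: algebra_simps)
qed

lemma aligned_top_step:
  assumes n: "0 < n" and c: "tower n (nsphere n) antipode c" and j: "Suc j \<le> n"
    and al: "aligned n c j k y"
    and x: "singular_chain (Suc j) (nsphere n) x"
    and y: "even_chain (chain_boundary (Suc j) x - (y + chain_map j antipode y))"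
  shows "aligned_top n c (Suc j) k x"
proof -
  let ?S = "nsphere n" and ?a = "chain_map (Suc j) antipode"
  obtain v where v: "singular_chain (Suc j) ?S v"
    and ev: "even_chain (chain_boundary (Suc j)
        (x - frag_cmul k (c (Suc j)) - (v + ?a v)))"
    using aligned_step_cycle [OF c _ al x y] j by auto
  let ?t = "x - frag_cmul k (c (Suc j)) - (v + ?a v)"
  have t: "singular_chain (Suc j) ?S ?t"
    using x v j tower_singular_chain [OF c, of "Suc j"]
    by (intro singular_chain_diff singular_chain_add singular_chain_cmul
        singular_chain_chain_map [OF _ continuous_map_antipode]) auto
  have "bounds_mod2 (Suc j) ?S (?t + ?a ?t)"
  proof (cases "Suc j = n")
    case True
    obtain z where z: "singular_relcycle (Suc j) ?S {} z" "even_chain (?t - z)"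
      using mod2_cycle_lifts [OF acyclic_below_nsphere [OF n] _ _ t ev] j by auto
    have "bounds_mod2 (Suc j) ?S (z + ?a z)"
      using antipode_cycle_sum_bounds_mod2 [OF n] z(1) True by blast
    moreover have "even_chain ((?t + ?a ?t) - (z + ?a z))"
      using even_chain_add [OF z(2) even_chain_chain_map [OF z(2), of "Suc j" antipode]]
      by (simp only: chain_map_diff add_diff_add)
    ultimately show ?thesis
      by (rule bounds_mod2_even_diff)
  next
    case False
    then have "bounds_mod2 (Suc j) ?S ?t"
      using bounds_mod2_if_acyclic [OF acyclic_below_nsphere [OF n] _ _ t ev] j by simp
    then show ?thesis
      by (intro bounds_mod2_add bounds_mod2_chain_map [OF _ continuous_map_antipode])
  qed
  moreover have "?a (?a v) = v"
    using chain_map_involution [OF v, of antipode] by simp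
  then have "(x + ?a x - frag_cmul k (c (Suc j) + ?a (c (Suc j)))) - (?t + ?a ?t) = (v + ?a v) + (v + ?a v)"
    by (simp add: chain_map_diff chain_map_add frag_cmul_distrib2 algebra_simps)
  then have "even_chain ((x + ?a x - frag_cmul k (c (Suc j) + ?a (c (Suc j)))) - (?t + ?a ?t))"
    by (simp only: even_chain_double)
  ultimately show ?thesis
    unfolding aligned_top_def by (rule bounds_mod2_even_diff)
qed

text \<open>Any two antipodal towers are aligned, so all of them have the same top class as the hemispherical one. Applied to the image of a tower under
an odd map, this says that odd maps have odd degree.\<close>

theorem tower_top_essential:
  assumes n: "0 < n" and d: "tower n (nsphere n) antipode d"
  shows "\<not> bounds_mod2 n (nsphere n) (d n + chain_map n antipode (d n))"
proof -
  obtain c where c: "tower n (nsphere n) antipode c"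
    and ess: "\<not> bounds_mod2 n (nsphere n) (c n + chain_map n antipode (c n))"
    by (rule essential_tower_nsphere)
  have al: "aligned n c j 1 (d j)" if "j < n" for j
    using that
  proof (induction j)
    case 0
    obtain s where s: "d 0 = frag_of s" using d by (auto simp: tower_def)
    then show ?case
      using aligned_point [OF n c, of s] tower_singular_chain [OF d, of 0] by (simp add: singular_chain_of)
  next
    case (Suc j)
    then show ?case
      using aligned_step [OF n c Suc.prems] tower_singular_chain [OF d] tower_boundary [OF d] by simp
  qed
  obtain m where m: "n = Suc m" using n by (cases n) auto
  have "aligned_top n c (Suc m) 1 (d (Suc m))"
    using aligned_top_step [OF n c _ al [of m]] tower_singular_chain [OF d] tower_boundary [OF d] m by simp
  then show ?thesis
    using ess bounds_mod2_cong unfolding aligned_top_def m [symmetric] frag_cmul_one by blast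
qed

section \<open>Double towers\<close>

abbreviation orbit_sum :: "nat \<Rightarrow> ('a \<Rightarrow> 'a) \<Rightarrow> 'a chain \<Rightarrow> 'a chain" where
  "orbit_sum p f c \<equiv> c + chain_map p f c"

lemma even_chain_orbit_sum: "even_chain c \<Longrightarrow> even_chain (orbit_sum p f c)"
  by (intro even_chain_add even_chain_chain_map)

text \<open>A tower in two directions, for a pair of commuting involutions \<open>f\<close> and \<open>g\<close>. It plays the part of the product of two towers: the
chain with index \<open>(i, j)\<close> has degree \<open>i + j\<close> and is chosen such that its boundary obeys the Leibniz rule. Choosing it by
contractibility of \<open>W i j\<close> makes cross products of singular chains unnecessary.\<close>

function double_tower ::
  "(nat \<Rightarrow> nat \<Rightarrow> 'a topology) \<Rightarrow> ('a \<Rightarrow> 'a) \<Rightarrow> ('a \<Rightarrow> 'a) \<Rightarrow> 'a chain \<Rightarrow> nat \<Rightarrow> nat \<Rightarrow> 'a chain" where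
  "double_tower W f g p i j =
    (if i = 0 \<and> j = 0 then p
     else SOME v. singular_chain (i + j) (W i j) v \<and>
       even_chain (chain_boundary (i + j) v -
         ((if i = 0 then 0 else orbit_sum (i + j - 1) f (double_tower W f g p (i - 1) j)) +
          (if j = 0 then 0 else orbit_sum (i + j - 1) g (double_tower W f g p i (j - 1))))))"
  by auto
termination by (relation "Wellfounded.measure (\<lambda>(W, f, g, p, i, j). i + j)") auto

declare double_tower.simps [simp del]

text \<open>The prescribed boundary is \<open>(1 + f) x\<^sub>i\<^sub>-\<^sub>1\<^sub>,\<^sub>j + (1 + g) x\<^sub>i\<^sub>,\<^sub>j\<^sub>-\<^sub>1\<close>. It is a cycle modulo two: the squares of \<open>1 + f\<close> and \<open>1 + g\<close> are even, and
the two mixed terms \<open>(1 + f) (1 + g) x\<^sub>i\<^sub>-\<^sub>1\<^sub>,\<^sub>j\<^sub>-\<^sub>1\<close> agree, as \<open>f\<close> and \<open>g\<close> commute.\<close>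

lemma double_tower_exists:
  fixes W :: "nat \<Rightarrow> nat \<Rightarrow> 'a topology"
  assumes contr: "\<And>i j. contractible_space (W i j)" and ne: "topspace (W 0 0) \<noteq> {}"
    and id1: "\<And>i j. continuous_map (W i j) (W (Suc i) j) id"
    and f: "\<And>i j. continuous_map (W i j) (W (Suc i) j) f"
    and id2: "\<And>i j. continuous_map (W i j) (W i (Suc j)) id"
    and g: "\<And>i j. continuous_map (W i j) (W i (Suc j)) g"
    and ff: "\<And>x. f (f x) = x" and gg: "\<And>x. g (g x) = x" and fg: "\<And>x. f (g x) = g (f x)"
  obtains x where "\<And>i j. singular_chain (i + j) (W i j) (x i j)" "\<exists>s. x 0 0 = frag_of s"
    "\<And>i j. 0 < i + j \<Longrightarrow> even_chain (chain_boundary (i + j) (x i j) -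
         ((if i = 0 then 0 else orbit_sum (i + j - 1) f (x (i - 1) j)) +
          (if j = 0 then 0 else orbit_sum (i + j - 1) g (x i (j - 1)))))"
proof -
  obtain z where z: "z \<in> topspace (W 0 0)" using ne by blast
  define s where "s = restrict (\<lambda>_. z) (standard_simplex 0)"
  have s: "singular_simplex 0 (W 0 0) s"
    using z by (simp add: s_def singular_simplex_def)
  define x where "x = double_tower W f g (frag_of s)"
  have x00: "x 0 0 = frag_of s"
    by (simp add: x_def double_tower.simps)
  define A where "A = (\<lambda>i j. if i = 0 then 0 else orbit_sum (i + j - 1) f (x (i - 1) j))"
  define B where "B = (\<lambda>i j. if j = 0 then 0 else orbit_sum (i + j - 1) g (x i (j - 1)))"
  have acyc: "acyclic_below m (W i j)" for m i j
    by (rule acyclic_below_contractible [OF contr])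
  have main: "singular_chain (i + j) (W i j) (x i j) \<and>
      (0 < i + j \<longrightarrow> even_chain (chain_boundary (i + j) (x i j) - (A i j + B i j)))" for i j
  proof (induction "i + j" arbitrary: i j rule: less_induct)
    case less
    show ?case
    proof (cases "i + j = 0")
      case True
      then show ?thesis
        using s x00 by (simp add: singular_chain_of)
    next
      case False
      define q where "q = i + j - 1"
      have ij: "i + j = Suc q" using False by (simp add: q_def)
      have inv: "chain_map p f (chain_map p f c) = c" "chain_map p g (chain_map p g c) = c"
          "chain_map p f (chain_map p g c) = chain_map p g (chain_map p f c)"
        if "singular_chain p (W k l) c" for p k l c
        using chain_map_involution [OF that ff] chain_map_involution [OF that gg]
          chain_map_eq [OF that, of "f \<circ> g" "g \<circ> f"] fg by (simp_all add: chain_map_compose)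
      have chA: "singular_chain q (W i j) (A i j)"
      proof (cases i)
        case (Suc k)
        then have "singular_chain q (W k j) (x k j)"
          using less [of k j] ij by simp
        then show ?thesis
          using id1 f by (auto simp: A_def Suc q_def intro!: singular_chain_add
              intro: singular_chain_inclusion singular_chain_chain_map)
      qed (simp add: A_def)
      have chB: "singular_chain q (W i j) (B i j)"
      proof (cases j)
        case (Suc k)
        then have "singular_chain q (W i k) (x i k)"
          using less [of i k] ij by simp
        then show ?thesis
          using id2 g by (auto simp: B_def Suc q_def intro!: singular_chain_add
              intro: singular_chain_inclusion singular_chain_chain_map)
      qed (simp add: B_def)
      have "bounds_mod2 q (W i j) (A i j + B i j)"
      proof (cases "q = 0")
        case True
        have W: "path_connected_space (W i j)"
          using acyc by (auto simp: acyclic_below_def)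
        consider "i = 1" "j = 0" | "i = 0" "j = 1"
          using ij True by linarith
        then show ?thesis
        proof cases
          case 1
          have "singular_simplex 0 (W 1 0) s" "singular_simplex 0 (W 1 0) (simplex_map 0 f s)"
            using singular_chain_inclusion [OF _ id1 [of 0 0], of 0 "frag_of s"]
              singular_simplex_simplex_map [OF s f [of 0 0]] s by (simp_all add: singular_chain_of)
          then show ?thesis
            using bounds_mod2_two_points [OF W] 1 by (simp add: A_def B_def x00 True)
        next
          case 2
          have "singular_simplex 0 (W 0 1) s" "singular_simplex 0 (W 0 1) (simplex_map 0 g s)"
            using singular_chain_inclusion [OF _ id2 [of 0 0], of 0 "frag_of s"]
              singular_simplex_simplex_map [OF s g [of 0 0]] s by (simp_all add: singular_chain_of)
          then show ?thesis
            using bounds_mod2_two_points [OF W] 2 by (simp add: A_def B_def x00 True)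
        qed
      next
        case False
        then obtain r where r: "q = Suc r" by (cases q) auto
        have bA: "even_chain (chain_boundary q (A i j) - (if i = 0 then 0 else orbit_sum r f (B (i - 1) j)))"
        proof (cases i)
          case (Suc k)
          have kj: "k + j = Suc r" using ij r Suc by simp
          then have ch: "singular_chain q (W k j) (x k j)"
            and ev: "even_chain (chain_boundary q (x k j) - (A k j + B k j))"
            using less [of k j] ij r by simp_all
          have "even_chain (orbit_sum r f (A k j))"
          proof (cases k)
            case (Suc l)
            then have "singular_chain r (W l j) (x l j)"
              using less [of l j] ij kj r by simp
            then have "orbit_sum r f (A k j) = orbit_sum r f (x l j) + orbit_sum r f (x l j)"
              using inv(1) kj Suc by (simp add: A_def chain_map_add algebra_simps)
            then show ?thesis by simp
          qed (simp add: A_def)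
          moreover have "chain_boundary q (A i j) - orbit_sum r f (B k j)
             = orbit_sum r f (chain_boundary q (x k j) - (A k j + B k j)) + orbit_sum r f (A k j)"
            using chain_boundary_chain_map [OF ch, of f] Suc kj r
            by (simp add: A_def chain_boundary_add chain_map_diff chain_map_add algebra_simps)
          ultimately have "even_chain (chain_boundary q (A i j) - orbit_sum r f (B k j))"
            by (simp only: even_chain_add even_chain_orbit_sum ev)
          then show ?thesis
            using Suc by simp
        qed (simp add: A_def)
        have bB: "even_chain (chain_boundary q (B i j) - (if j = 0 then 0 else orbit_sum r g (A i (j - 1))))"
        proof (cases j)
          case (Suc k)
          have kj: "i + k = Suc r" using ij r Suc by simp
          then have ch: "singular_chain q (W i k) (x i k)"
            and ev: "even_chain (chain_boundary q (x i k) - (A i k + B i k))"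
            using less [of i k] ij r by simp_all
          have "even_chain (orbit_sum r g (B i k))"
          proof (cases k)
            case (Suc l)
            then have "singular_chain r (W i l) (x i l)"
              using less [of i l] ij kj r by simp
            then have "orbit_sum r g (B i k) = orbit_sum r g (x i l) + orbit_sum r g (x i l)"
              using inv(2) kj Suc by (simp add: B_def chain_map_add algebra_simps)
            then show ?thesis by simp
          qed (simp add: B_def)
          moreover have "chain_boundary q (B i j) - orbit_sum r g (A i k)
             = orbit_sum r g (chain_boundary q (x i k) - (A i k + B i k)) + orbit_sum r g (B i k)"
            using chain_boundary_chain_map [OF ch, of g] Suc kj r
            by (simp add: B_def chain_boundary_add chain_map_diff chain_map_add algebra_simps)
          ultimately have "even_chain (chain_boundary q (B i j) - orbit_sum r g (A i k))"
            by (simp only: even_chain_add even_chain_orbit_sum ev)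
          then show ?thesis
            using Suc by simp
        qed (simp add: B_def)
        have mixed: "even_chain ((if i = 0 then 0 else orbit_sum r f (B (i - 1) j))
            + (if j = 0 then 0 else orbit_sum r g (A i (j - 1))))"
        proof (cases "i = 0 \<or> j = 0")
          case True
          then show ?thesis by (auto simp: A_def B_def)
        next
          case False
          then obtain k l where kl: "i = Suc k" "j = Suc l"
            by (meson not0_implies_Suc)
          then have "singular_chain r (W k l) (x k l)"
            using less [of k l] ij r by simp
          then have "orbit_sum r f (B k j) = orbit_sum r g (A i l)"
            using inv(3) kl ij r by (simp add: A_def B_def chain_map_add algebra_simps)
          then show ?thesis
            using kl by simp
        qed
        have "(a - b) + (c - d) + (b + d) = a + c" for a b c d :: "'a chain"
          by simp
        then have "even_chain (chain_boundary q (A i j + B i j))"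
          using even_chain_add [OF even_chain_add [OF bA bB] mixed]
          by (simp only: chain_boundary_add)
        then show ?thesis
          using bounds_mod2_if_acyclic [OF acyc [of "Suc q"] _ _ singular_chain_add [OF chA chB]] False by simp
      qed
      then obtain v where v: "singular_chain (i + j) (W i j) v"
          "even_chain (A i j + B i j - chain_boundary (i + j) v)"
        unfolding bounds_mod2_def ij by blast
      have "even_chain (chain_boundary (i + j) v - (A i j + B i j))"
        using even_chain_minus [OF v(2)] by simp
      then have ex: "\<exists>v. singular_chain (i + j) (W i j) v \<and>
          even_chain (chain_boundary (i + j) v - (A i j + B i j))"
        using v(1) by blast
      have "x i j = (SOME v. singular_chain (i + j) (W i j) v \<and>
          even_chain (chain_boundary (i + j) v - (A i j + B i j)))"
        unfolding x_def A_def B_def using False by (subst double_tower.simps) auto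
      then show ?thesis
        using someI_ex [OF ex] by simp
    qed
  qed
  show thesis
  proof (rule that [of x])
    show "singular_chain (i + j) (W i j) (x i j)" for i j
      using main [of i j] by (rule conjunct1)
    show "even_chain (chain_boundary (i + j) (x i j) -
         ((if i = 0 then 0 else orbit_sum (i + j - 1) f (x (i - 1) j)) +
          (if j = 0 then 0 else orbit_sum (i + j - 1) g (x i (j - 1)))))" if "0 < i + j" for i j
      using mp [OF conjunct2 [OF main [of i j]] that] unfolding A_def B_def .
  qed (use x00 in blast)
qed

section \<open>Bi-odd maps\<close>

text \<open>This is the theorem of Hopf and Stiefel. In cohomology: the map induces \<open>\<real>P\<^sup>r \<times> \<real>P\<^sup>n \<rightarrow> \<real>P\<^sup>n\<close>, the generator pulls back to \<open>s + t\<close>, and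
\<open>(s + t)\<^sup>n\<^sup>+\<^sup>1 = 0\<close> forces \<open>n + 1 choose i\<close> to be even for \<open>0 < i \<le> r\<close>, which by Pascal's rule means that \<open>n choose k\<close> is odd for \<open>k \<le> r\<close>.

The proof works with chains instead. A double tower of products of hemispheres has images \<open>e\<^sub>i\<^sub>,\<^sub>j\<close> in
the \<open>n\<close>-sphere with \<open>\<partial>e\<^sub>i\<^sub>,\<^sub>j = (1 + a) (e\<^sub>i\<^sub>-\<^sub>1\<^sub>,\<^sub>j + e\<^sub>i\<^sub>,\<^sub>j\<^sub>-\<^sub>1)\<close> modulo two. Hence the multiplicity of \<open>e\<^sub>i\<^sub>,\<^sub>j\<close> over the reference
tower satisfies Pascal's recursion and is \<open>i + j choose i\<close>. In degree \<open>n + 1\<close> the boundary formula says that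
the top classes of \<open>e\<^sub>k\<^sub>,\<^sub>n\<^sub>-\<^sub>k\<close> and \<open>e\<^sub>k\<^sub>+\<^sub>1\<^sub>,\<^sub>n\<^sub>-\<^sub>k\<^sub>-\<^sub>1\<close> agree; so all of them agree with the one for \<open>k = 0\<close>, which is
the essential class.\<close>

theorem bi_odd_map_binomials_odd:
  assumes n: "0 < n"
    and f: "continuous_map (prod_topology (nsphere r) (nsphere n)) (nsphere n) f"
    and odd1: "\<And>u x. u \<in> topspace (nsphere r) \<Longrightarrow> x \<in> topspace (nsphere n) \<Longrightarrow>
        f (antipode u, x) = antipode (f (u, x))"
    and odd2: "\<And>u x. u \<in> topspace (nsphere r) \<Longrightarrow> x \<in> topspace (nsphere n) \<Longrightarrow>
        f (u, antipode x) = antipode (f (u, x))"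
    and k: "k \<le> r"
  shows "odd (n choose k)"
proof -
  let ?S = "nsphere n" and ?a = "\<lambda>p. chain_map p antipode" and ?P = "prod_topology (nsphere r) (nsphere n)"
  define \<alpha> where "\<alpha> = (\<lambda>(u, x). (antipode u, x :: nat \<Rightarrow> real))"
  define \<beta> where "\<beta> = (\<lambda>(u :: nat \<Rightarrow> real, x). (u, antipode x))"
  define W where "W = (\<lambda>i j. prod_topology (upper_hemisphere i) (upper_hemisphere j))"
  have id0: "continuous_map (upper_hemisphere i) (nsphere i) id" for i
    by (intro continuous_map_from_subtopology) simp
  have id1: "continuous_map (upper_hemisphere i) (upper_hemisphere (Suc i)) id" for i
    using continuous_map_compose [OF id0 continuous_map_nsphere_upper_hemisphere] by simp
  have ant: "continuous_map (upper_hemisphere i) (upper_hemisphere (Suc i)) antipode" for i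
    using continuous_map_compose [OF continuous_map_compose [OF id0 continuous_map_antipode]
        continuous_map_nsphere_upper_hemisphere] by simp
  have prod: "continuous_map (prod_topology X Y) (prod_topology X' Y') (\<lambda>(u, x). (g u, h x))"
    if "continuous_map X X' g" "continuous_map Y Y' h"
    for X Y X' Y' :: "(nat \<Rightarrow> real) topology" and g h
    using that by (simp add: continuous_map_prod_top)
  have idp: "id = (\<lambda>(u, x). (id u, id x))"
    by auto
  obtain x where x: "\<And>i j. singular_chain (i + j) (W i j) (x i j)" and x00: "\<exists>s. x 0 0 = frag_of s"
    and bx: "\<And>i j. 0 < i + j \<Longrightarrow> even_chain (chain_boundary (i + j) (x i j) -
         ((if i = 0 then 0 else orbit_sum (i + j - 1) \<alpha> (x (i - 1) j)) +
          (if j = 0 then 0 else orbit_sum (i + j - 1) \<beta> (x i (j - 1)))))"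
  proof (rule double_tower_exists [of W \<alpha> \<beta>])
    show "contractible_space (W i j)" for i j
      by (simp add: W_def contractible_space_prod_topology contractible_upper_hemisphere)
    show "topspace (W 0 0) \<noteq> {}"
      using in_topspace_nsphere [of 0] by (auto simp: W_def)
    show "continuous_map (W i j) (W (Suc i) j) id" for i j
      unfolding W_def by (subst idp, intro prod id1 continuous_map_id)
    show "continuous_map (W i j) (W i (Suc j)) id" for i j
      unfolding W_def by (subst idp, intro prod id1 continuous_map_id)
    show "continuous_map (W i j) (W (Suc i) j) \<alpha>" for i j
      using prod [OF ant continuous_map_id] by (simp add: W_def \<alpha>_def)
    show "continuous_map (W i j) (W i (Suc j)) \<beta>" for i j
      using prod [OF continuous_map_id ant] by (simp add: W_def \<beta>_def)
  qed (auto simp: \<alpha>_def \<beta>_def)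
  have W: "continuous_map (W i j) ?P id" if "i \<le> r" "j \<le> n" for i j
    unfolding W_def using that
    by (subst idp, intro prod continuous_map_from_subtopology continuous_map_nsphere_le)
  have xP: "singular_chain (i + j) ?P (x i j)" if "i \<le> r" "j \<le> n" for i j
    by (rule singular_chain_inclusion [OF x W [OF that]])
  define e where "e = (\<lambda>i j. chain_map (i + j) f (x i j))"
  have e: "singular_chain (i + j) ?S (e i j)" if "i \<le> r" "j \<le> n" for i j
    unfolding e_def by (rule singular_chain_chain_map [OF xP [OF that] f])
  have f\<alpha>: "chain_map p f (chain_map p \<alpha> c) = ?a p (chain_map p f c)" if "singular_chain p ?P c" for p c
    using chain_map_eq [OF that, of "f \<circ> \<alpha>" "antipode \<circ> f"] odd1 by (force simp: chain_map_compose \<alpha>_def)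
  have f\<beta>: "chain_map p f (chain_map p \<beta> c) = ?a p (chain_map p f c)" if "singular_chain p ?P c" for p c
    using chain_map_eq [OF that, of "f \<circ> \<beta>" "antipode \<circ> f"] odd2 by (force simp: chain_map_compose \<beta>_def)
  define y where "y = (\<lambda>i j. (if i = 0 then 0 else e (i - 1) j) + (if j = 0 then 0 else e i (j - 1)))"
  have be: "even_chain (chain_boundary (Suc p) (e i j) - (y i j + ?a p (y i j)))"
    if ij: "i \<le> r" "j \<le> n" and p: "i + j = Suc p" for i j p
  proof -
    let ?A = "if i = 0 then 0 else orbit_sum p \<alpha> (x (i - 1) j)"
      and ?B = "if j = 0 then 0 else orbit_sum p \<beta> (x i (j - 1))"
    have "chain_map p f ?A = (if i = 0 then 0 else e (i - 1) j + ?a p (e (i - 1) j))"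
    proof (cases i)
      case (Suc l)
      then show ?thesis
        using f\<alpha> [of p "x l j"] xP [of l j] ij p by (simp add: chain_map_add e_def)
    qed simp
    moreover have "chain_map p f ?B = (if j = 0 then 0 else e i (j - 1) + ?a p (e i (j - 1)))"
    proof (cases j)
      case (Suc l)
      then show ?thesis
        using f\<beta> [of p "x i l"] xP [of i l] ij p by (simp add: chain_map_add e_def)
    qed simp
    ultimately have "chain_map p f (?A + ?B) = y i j + ?a p (y i j)"
      by (simp add: y_def chain_map_add)
    moreover have "chain_map p f (chain_boundary (Suc p) (x i j)) = chain_boundary (Suc p) (e i j)"
      using chain_boundary_chain_map [OF xP [OF ij], of f] p by (simp add: e_def)
    moreover have "even_chain (chain_map p f (chain_boundary (Suc p) (x i j) - (?A + ?B)))"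
      using even_chain_chain_map [OF bx [of i j], of p f] unfolding p diff_Suc_1 by blast
    ultimately show ?thesis
      by (simp only: chain_map_diff)
  qed
  obtain c where c: "tower n ?S antipode c"
    and ess: "\<not> bounds_mod2 n ?S (c n + ?a n (c n))"
    by (rule essential_tower_nsphere)
  \<comment> \<open>Pascal's rule, in the form in which it enters: both neighbours of (i, j) in degree p are aligned.\<close>
  have aly: "aligned n c p (int (Suc p choose i)) (y i j)"
    if i: "i \<le> r" and ij: "i + j = Suc p"
      and al: "\<And>i j. i \<le> r \<Longrightarrow> i + j = p \<Longrightarrow> aligned n c p (int (p choose i)) (e i j)" for i j p
  proof -
    have "aligned n c p (if i = 0 then 0 else int (p choose (i - 1))) (if i = 0 then 0 else e (i - 1) j)"
      using al [of "i - 1" j] i ij by (cases i) (auto simp: aligned_0)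
    moreover have "aligned n c p (if j = 0 then 0 else int (p choose i)) (if j = 0 then 0 else e i (j - 1))"
      using al [of i "j - 1"] i ij by (cases j) (auto simp: aligned_0)
    ultimately have "aligned n c p ((if i = 0 then 0 else int (p choose (i - 1)))
        + (if j = 0 then 0 else int (p choose i))) (y i j)"
      unfolding y_def by (rule aligned_add)
    moreover have "(if i = 0 then 0 else int (p choose (i - 1))) + (if j = 0 then 0 else int (p choose i))
        = int (Suc p choose i)"
      using ij by (cases i; cases j) auto
    ultimately show ?thesis by simp
  qed
  have al: "aligned n c m (int (m choose i)) (e i j)" if "m < n" "i \<le> r" "i + j = m" for i j m
    using that
  proof (induction m arbitrary: i j)
    case 0
    then obtain s where s: "e 0 0 = frag_of s"
      using x00 by (auto simp: e_def)
    have "singular_simplex 0 ?S s"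
      using e [of 0 0] by (simp add: s singular_chain_of)
    then have "aligned n c 0 1 (e 0 0)"
      unfolding s by (rule aligned_point [OF n c])
    then show ?case
      using 0 by simp
  next
    case (Suc p)
    have "aligned n c p (int (Suc p choose i)) (y i j)"
      using Suc.prems by (intro aly Suc.IH) simp_all
    then show ?case
      using aligned_step [OF n c Suc.prems(1) _ _ be] Suc.prems e [of i j] by simp
  qed
  have top: "bounds_mod2 n ?S (e i j + ?a n (e i j) - frag_cmul (int (n choose i)) (c n + ?a n (c n)))"
    if i: "i \<le> r" and ij: "i + j = n" for i j
  proof -
    obtain p where p: "n = Suc p" using n by (cases n) auto
    have "aligned n c p (int (Suc p choose i)) (y i j)"
      using i ij p by (intro aly al) simp_all
    then have "aligned_top n c (Suc p) (int (Suc p choose i)) (e i j)"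
      using aligned_top_step [OF n c _ _ _ be] i ij p e [of i j] by simp
    then show ?thesis
      by (simp add: aligned_top_def p)
  qed
  have odd_if_ess: "odd (n choose i)"
    if "i \<le> r" "i + j = n" "\<not> bounds_mod2 n ?S (e i j + ?a n (e i j))" for i j
  proof
    assume "even (n choose i)"
    then have "even_chain (frag_cmul (int (n choose i)) (c n + ?a n (c n)))"
      by (intro even_chain_even_cmul) simp
    then show False
      using bounds_mod2_cong [OF top [OF that(1,2)]] bounds_mod2_even that(3) by blast
  qed
  have "k \<le> n \<and> \<not> bounds_mod2 n ?S (e k (n - k) + ?a n (e k (n - k)))"
    using k
  proof (induction k)
    case 0
    show ?case
      using ess bounds_mod2_cong [OF top [of 0 n]] by simp
  next
    case (Suc k)
    then have IH: "k \<le> n" "\<not> bounds_mod2 n ?S (e k (n - k) + ?a n (e k (n - k)))"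
      by simp_all
    \<comment> \<open>A chain of degree \<open>n + 1\<close>: its boundary relates the top classes for \<open>k\<close> and \<open>k + 1\<close>.\<close>
    let ?v = "e (Suc k) (n - k)"
    have "singular_chain (Suc n) ?S ?v"
      using e [of "Suc k" "n - k"] Suc.prems IH(1) by simp
    moreover have "even_chain (y (Suc k) (n - k) + ?a n (y (Suc k) (n - k)) - chain_boundary (Suc n) ?v)"
      using even_chain_minus [OF be [of "Suc k" "n - k" n]] Suc.prems IH(1) by simp
    ultimately have b: "bounds_mod2 n ?S (y (Suc k) (n - k) + ?a n (y (Suc k) (n - k)))"
      unfolding bounds_mod2_def by blast
    \<comment> \<open>For \<open>k = n\<close> the second summand is absent, and the essential class would bound.\<close>
    have "k \<noteq> n"
      using b IH(2) by (auto simp: y_def)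
    then have kn: "Suc k \<le> n" "n - k = Suc (n - Suc k)"
      using IH(1) by auto
    let ?e = "e k (n - k)" and ?e' = "e (Suc k) (n - Suc k)"
    have "y (Suc k) (n - k) = ?e + ?e'"
      using kn by (simp add: y_def)
    then have "y (Suc k) (n - k) + ?a n (y (Suc k) (n - k)) = (?e + ?a n ?e) + (?e' + ?a n ?e')"
      by (simp add: chain_map_add algebra_simps)
    then have "bounds_mod2 n ?S ((?e + ?a n ?e) + (?e' + ?a n ?e'))"
      using b by simp
    then have "bounds_mod2 n ?S (?e + ?a n ?e)" if "bounds_mod2 n ?S (?e' + ?a n ?e')"
      using bounds_mod2_diff [OF _ that] by fastforce
    then show ?case
      using IH(2) kn(1) by blast
  qed
  then show ?thesis
    using odd_if_ess [OF k, of "n - k"] by simp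
qed

section \<open>Involutions\<close>

definition unit_vector :: "nat \<Rightarrow> (nat \<Rightarrow> real) \<Rightarrow> nat \<Rightarrow> real" where
  "unit_vector n v = (\<lambda>i. v i / sqrt (\<Sum>j\<le>n. (v j)\<^sup>2))"

lemma unit_vector_eq_self: "x \<in> topspace (nsphere n) \<Longrightarrow> unit_vector n x = x"
  by (simp add: unit_vector_def topspace_nsphere)

lemma unit_vector_antipode: "unit_vector n (antipode v) = antipode (unit_vector n v)"
  by (auto simp: unit_vector_def antipode_apply)

lemma sum_squares_pos:
  fixes v :: "nat \<Rightarrow> real"
  assumes "\<forall>i>n. v i = 0" "v \<noteq> (\<lambda>i. 0)"
  shows "0 < (\<Sum>j\<le>n. (v j)\<^sup>2)"
proof -
  obtain i where i: "v i \<noteq> 0" using assms(2) by auto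
  have "i \<le> n" using spec [OF assms(1), of i] i by (cases "n < i") auto
  then show ?thesis
    using i by (intro sum_pos2 [of _ i]) auto
qed

lemma continuous_map_unit_vector:
  assumes g: "\<And>i. continuous_map X euclideanreal (\<lambda>x. g x i)"
    and nz: "\<And>x. x \<in> topspace X \<Longrightarrow> (\<forall>i>n. g x i = 0) \<and> g x \<noteq> (\<lambda>i. 0)"
  shows "continuous_map X (nsphere n) (\<lambda>x. unit_vector n (g x))"
  unfolding continuous_map_into_nsphere
proof (intro conjI allI Pi_I)
  have pos: "0 < (\<Sum>j\<le>n. (g x j)\<^sup>2)" if "x \<in> topspace X" for x
    using sum_squares_pos nz [OF that] by blast
  show "continuous_map X euclideanreal (\<lambda>x. unit_vector n (g x) i)" for i
    unfolding unit_vector_def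
    by (intro continuous_map_real_divide g continuous_map_sqrt continuous_map_sum continuous_map_real_pow)
      (use pos in force)+
  show "unit_vector n (g x) \<in> topspace (nsphere n)" if "x \<in> topspace X" for x
    using pos [OF that] nz [OF that]
    by (simp add: topspace_nsphere unit_vector_def power_divide flip: sum_divide_distrib)
qed

text \<open>In other words, a free involution \<open>T\<close> and the antipodal map must agree somewhere. Suppose that \<open>T x\<close> is never \<open>x\<close> or \<open>- x\<close>. Then \<open>x - T x\<close> and \<open>x + T x\<close> never vanish, and
normalizing them gives maps \<open>h\<close> and \<open>g\<close> of the sphere with \<open>h T = - h\<close> and \<open>g T = g\<close>; moreover \<open>g\<close> is homotopic to the identity. Take the top cycle
\<open>b + T b\<close> of a tower for \<open>T\<close>. Its image under \<open>g\<close> is \<open>2 g b\<close>, so it bounds modulo two. But \<open>h\<close> turns the tower into one for the antipodal map, whose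
top cycle does not bound.\<close>

theorem involution_of_sphere_meets_antipode:
  assumes n: "0 < n"
    and T: "continuous_map (nsphere n) (nsphere n) T"
    and TT: "\<And>x. x \<in> topspace (nsphere n) \<Longrightarrow> T (T x) = x"
  obtains x where "x \<in> topspace (nsphere n)" "T x = x \<or> T x = antipode x"
proof -
  let ?S = "nsphere n"
  have False if free: "\<And>x. x \<in> topspace ?S \<Longrightarrow> T x \<noteq> x \<and> T x \<noteq> antipode x"
  proof -
    have Tx: "T x \<in> topspace ?S" if "x \<in> topspace ?S" for x
      using continuous_map_funspace [OF T] that by auto
    have Tc: "continuous_map ?S euclideanreal (\<lambda>x. T x i)" for i
      using T by (simp add: continuous_map_into_nsphere)
    define h where "h = (\<lambda>x. unit_vector n (\<lambda>i. x i - T x i))"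
    define g where "g = (\<lambda>x. unit_vector n (\<lambda>i. x i + T x i))"
    have h: "continuous_map ?S ?S h"
      unfolding h_def
    proof (rule continuous_map_unit_vector)
      show "continuous_map ?S euclideanreal (\<lambda>x. x i - T x i)" for i
        by (intro continuous_map_diff continuous_map_nsphere_projection Tc)
      show "(\<forall>i>n. x i - T x i = 0) \<and> (\<lambda>i. x i - T x i) \<noteq> (\<lambda>i. 0)" if "x \<in> topspace ?S" for x
      proof
        show "\<forall>i>n. x i - T x i = 0"
          using that Tx [OF that] by (simp add: topspace_nsphere)
        show "(\<lambda>i. x i - T x i) \<noteq> (\<lambda>i. 0)"
          using free [OF that] by (metis eq_iff_diff_eq_0 ext)
      qed
    qed
    have hT: "h (T x) = antipode (h x)" if "x \<in> topspace ?S" for x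
    proof -
      have "(\<lambda>i. T x i - T (T x) i) = antipode (\<lambda>i. x i - T x i)"
        using TT [OF that] by (simp add: antipode_def)
      then show ?thesis
        by (simp only: h_def unit_vector_antipode)
    qed
    define H where "H = (\<lambda>(t, x). unit_vector n (\<lambda>i. x i + t * T x i))"
    have H: "continuous_map (prod_topology (top_of_set {0..1}) ?S) ?S H"
      unfolding H_def case_prod_unfold
    proof (rule continuous_map_unit_vector)
      let ?Q = "prod_topology (top_of_set {0..1::real}) ?S"
      have fst: "continuous_map ?Q euclideanreal fst"
        by (rule continuous_map_into_fulltopology [OF continuous_map_fst])
      show "continuous_map ?Q euclideanreal (\<lambda>p. snd p i + fst p * T (snd p) i)" for i
        using continuous_map_compose [OF continuous_map_snd continuous_map_nsphere_projection, of "top_of_set {0..1::real}" n i]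
          continuous_map_compose [OF continuous_map_snd Tc, of "top_of_set {0..1::real}" i]
        by (intro continuous_map_add continuous_map_real_mult fst) (simp_all add: o_def)
      fix p assume "p \<in> topspace ?Q"
      then obtain t x where p: "p = (t, x)" "0 \<le> t" "t \<le> 1" and x: "x \<in> topspace ?S"
        by (cases p) auto
      have "(\<lambda>i. x i + t * T x i) \<noteq> (\<lambda>i. 0)"
      proof
        assume "(\<lambda>i. x i + t * T x i) = (\<lambda>i. 0)"
        then have xi: "x i = - t * T x i" for i
          by (simp add: fun_eq_iff eq_neg_iff_add_eq_0)
        have "(\<Sum>i\<le>n. (x i)\<^sup>2) = t\<^sup>2 * (\<Sum>i\<le>n. (T x i)\<^sup>2)"
          by (simp add: xi [of _] power_mult_distrib sum_distrib_left)
        then have "t\<^sup>2 = 1"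
          using x Tx [OF x] by (simp add: topspace_nsphere)
        then have "t = 1"
          using p(2) by (simp add: power2_eq_1_iff)
        then have "T x = antipode x"
          using xi by (auto simp: fun_eq_iff antipode_apply)
        then show False
          using free [OF x] by simp
      qed
      then show "(\<forall>i>n. snd p i + fst p * T (snd p) i = 0) \<and> (\<lambda>i. snd p i + fst p * T (snd p) i) \<noteq> (\<lambda>i. 0)"
        using x Tx [OF x] by (simp add: p topspace_nsphere)
    qed
    \<comment> \<open>On the sphere, normalization is the identity; this form matches the homotopy at time zero literally.\<close>
    have hom: "homotopic_with (\<lambda>_. True) ?S ?S (\<lambda>x. unit_vector n x) g"
      unfolding homotopic_with_def
      using H by (intro exI [of _ H]) (auto simp: H_def g_def)
    have g: "continuous_map ?S ?S g"
      using homotopic_with_imp_continuous_maps [OF hom] by simp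
    have gT: "g (T x) = g x" if "x \<in> topspace ?S" for x
      using TT [OF that] by (simp add: g_def add.commute)
    obtain b where b: "tower n ?S T b"
      using tower_exists [OF acyclic_below_nsphere [OF n] _ T TT] in_topspace_nsphere [of n] by blast
    let ?z = "b n + chain_map n T (b n)"
    have bn: "singular_chain n ?S (b n)"
      using tower_singular_chain [OF b] by simp
    have "singular_chain n ?S ?z"
      using bn by (intro singular_chain_add singular_chain_chain_map [OF _ T])
    then obtain w where w: "singular_relcycle n ?S {} w" "even_chain (?z - w)"
      using mod2_cycle_lifts [OF acyclic_below_nsphere [OF n] n order_refl]
        tower_sum_mod2_cycle [OF b order_refl T TT] by blast
    have gz: "chain_map n g ?z = chain_map n g (b n) + chain_map n g (b n)"
      using chain_map_eq [OF bn, of "g \<circ> T" g] gT by (simp add: chain_map_add chain_map_compose)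
    have "homologous_rel n ?S {} (chain_map n (\<lambda>x. unit_vector n x) w) (chain_map n g w)"
      by (rule homotopic_imp_homologous_rel_chain_maps [OF _ w(1)])
        (use hom in \<open>auto elim: homotopic_with_mono\<close>)
    moreover have "chain_map n (\<lambda>x. unit_vector n x) w = w"
      using w(1) by (intro chain_map_id_gen [of n ?S]) (auto simp: singular_cycle unit_vector_eq_self)
    ultimately have wg: "bounds_mod2 n ?S (w - chain_map n g w)"
      by (simp add: homologous_rel_def bounds_mod2_relboundary)
    have "even_chain (chain_map n g ?z - chain_map n g (?z - w))"
    proof (rule even_chain_diff)
      show "even_chain (chain_map n g ?z)"
        unfolding gz by (rule even_chain_double)
      show "even_chain (chain_map n g (?z - w))"
        by (rule even_chain_chain_map [OF w(2)])
    qed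
    then have "even_chain (chain_map n g w)"
      by (simp add: chain_map_diff)
    then have "bounds_mod2 n ?S w"
      using wg bounds_mod2_cong bounds_mod2_even by blast
    then have "bounds_mod2 n ?S ?z"
      by (rule bounds_mod2_even_diff [OF _ w(2)])
    then have "bounds_mod2 n ?S (chain_map n h ?z)"
      by (rule bounds_mod2_chain_map [OF _ h])
    moreover have "chain_map n h ?z = chain_map n h (b n) + chain_map n antipode (chain_map n h (b n))"
      using chain_map_eq [OF bn, of "h \<circ> T" "antipode \<circ> h"] hT by (simp add: chain_map_add chain_map_compose)
    moreover have "tower n ?S antipode (\<lambda>j. chain_map j h (b j))"
      by (rule tower_image [OF b h]) (rule hT)
    ultimately show False
      using tower_top_essential [OF n] by force
  qed
  then show thesis using that by blast
qed

section \<open>Rotations of space\<close>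

definition skew_matrix :: "real \<Rightarrow> real \<Rightarrow> real \<Rightarrow> real ^ 3 ^ 3" where
  "skew_matrix a b c = vector [vector [0, - c, b], vector [c, 0, - a], vector [- b, a, 0]]"

text \<open>Rodrigues' formula for the rotation by the angle \<open>t\<close> about the unit vector \<open>u\<close>. The axis is a function on the
naturals, so that it can range over \<^term>\<open>nsphere 2\<close>.\<close>

definition rotation :: "(nat \<Rightarrow> real) \<Rightarrow> real \<Rightarrow> real ^ 3 ^ 3" where
  "rotation u t = mat 1 + sin t *\<^sub>R skew_matrix (u 0) (u 1) (u 2)
     + (1 - cos t) *\<^sub>R (skew_matrix (u 0) (u 1) (u 2) ** skew_matrix (u 0) (u 1) (u 2))"

lemma skew_matrix_minus: "skew_matrix (- a) (- b) (- c) = - skew_matrix a b c"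
  by (simp add: skew_matrix_def vec_eq_iff forall_3)

lemma transpose_skew_matrix: "transpose (skew_matrix a b c) = - skew_matrix a b c"
  by (simp add: skew_matrix_def vec_eq_iff forall_3 transpose_def)

lemma skew_matrix_square:
  "skew_matrix a b c ** skew_matrix a b c =
     vector [vector [- (b\<^sup>2 + c\<^sup>2), a * b, a * c], vector [a * b, - (a\<^sup>2 + c\<^sup>2), b * c],
       vector [a * c, b * c, - (a\<^sup>2 + b\<^sup>2)]]"
  by (simp add: skew_matrix_def vec_eq_iff forall_3 matrix_matrix_mult_def sum_3 power2_eq_square)

text \<open>The Cayley-Hamilton relation, the source of all identities for rotations about one axis.\<close>

lemma skew_matrix_cube:
  assumes "a\<^sup>2 + b\<^sup>2 + c\<^sup>2 = 1"
  shows "skew_matrix a b c ** (skew_matrix a b c ** skew_matrix a b c) = - skew_matrix a b c"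
proof -
  have "x * (a\<^sup>2 + b\<^sup>2 + c\<^sup>2) = x" for x
    using assms by simp
  from this [of a] this [of b] this [of c] show ?thesis
    unfolding skew_matrix_square
    by (simp add: skew_matrix_def vec_eq_iff forall_3 matrix_matrix_mult_def sum_3 power2_eq_square algebra_simps)
qed

lemma matrix_mult_minus_right: "A ** (- B) = - (A ** B)" for A B :: "real ^ 3 ^ 3"
  by (simp add: vec_eq_iff matrix_matrix_mult_def sum_negf)

lemma matrix_add_rdistrib: "(A + B) ** C = A ** C + B ** C" for A B C :: "real ^ 3 ^ 3"
  by (simp add: vec_eq_iff matrix_matrix_mult_def sum.distrib distrib_right)

lemma matrix_mult_minus_left: "(- A) ** B = - (A ** B)" for A B :: "real ^ 3 ^ 3"
  by (simp add: vec_eq_iff matrix_matrix_mult_def sum_negf)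

lemma sphere_2_iff: "u \<in> topspace (nsphere 2) \<longleftrightarrow> (u 0)\<^sup>2 + (u 1)\<^sup>2 + (u 2)\<^sup>2 = 1 \<and> (\<forall>i>2. u i = 0)"
  by (simp add: topspace_nsphere numeral_2_eq_2)

lemma rodrigues_product:
  fixes K :: "real ^ 3 ^ 3"
  assumes K3: "K ** (K ** K) = - K"
  shows "(mat 1 + p *\<^sub>R K + q *\<^sub>R (K ** K)) ** (mat 1 + p' *\<^sub>R K + q' *\<^sub>R (K ** K)) =
      mat 1 + (p + p' - p * q' - q * p') *\<^sub>R K + (q + q' + p * p' - q * q') *\<^sub>R (K ** K)"
proof -
  have K3': "(K ** K) ** K = - K"
    using K3 by (simp add: matrix_mul_assoc)
  have K4: "(K ** K) ** (K ** K) = - (K ** K)"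
    by (metis K3 matrix_mul_assoc matrix_mult_minus_right)
  show ?thesis
    by (simp add: matrix_add_ldistrib matrix_add_rdistrib matrix_scalar_ac scalar_matrix_assoc [symmetric] K3 K3' K4)
      (simp add: algebra_simps)
qed

lemma rotation_add:
  assumes "u \<in> topspace (nsphere 2)"
  shows "rotation u s ** rotation u t = rotation u (s + t)"
proof -
  define K where "K = skew_matrix (u 0) (u 1) (u 2)"
  have "K ** (K ** K) = - K"
    using assms unfolding K_def by (intro skew_matrix_cube) (simp add: sphere_2_iff)
  from rodrigues_product [OF this, of "sin s" "1 - cos s" "sin t" "1 - cos t"] show ?thesis
    unfolding rotation_def K_def [symmetric] by (simp add: sin_add cos_add algebra_simps)
qed

lemma rotation_0 [simp]: "rotation u 0 = mat 1"
  by (simp add: rotation_def)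

lemma rotation_2pi: "rotation u (2 * pi) = mat 1"
  by (simp add: rotation_def)

lemma rotation_antipode: "rotation (antipode u) t = rotation u (- t)"
  by (simp add: rotation_def antipode_apply skew_matrix_minus matrix_mult_minus_right matrix_mult_minus_left)

lemma transpose_rotation: "transpose (rotation u t) = rotation u (- t)"
proof -
  have "transpose (A + B) = transpose A + transpose B" for A B :: "real ^ 3 ^ 3"
    by (simp add: transpose_def vec_eq_iff)
  then show ?thesis
    by (simp add: rotation_def transpose_scalar matrix_transpose_mul transpose_skew_matrix
        matrix_mult_minus_right matrix_mult_minus_left)
qed

text \<open>The determinant is \<open>1\<close>, and not \<open>-1\<close>, since the rotation is the square of the one by half the angle.\<close>

lemma rotation_in_SO3:
  assumes u: "u \<in> topspace (nsphere 2)"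
  shows "rotation u t \<in> carrier SO3"
proof -
  have orth: "orthogonal_matrix (rotation u s)" for s
    by (simp add: orthogonal_matrix transpose_rotation rotation_add [OF u])
  have "det (rotation u t) = det (rotation u (t / 2)) * det (rotation u (t / 2))"
    using rotation_add [OF u, of "t / 2" "t / 2"] by (metis det_mul field_sum_of_halves)
  also have "\<dots> = 1"
    using det_orthogonal_matrix [OF orth, of "t / 2"] by auto
  finally show ?thesis
    using orth by (simp add: SO3_def rotation_matrix_def)
qed

lemma half_turn_nontrivial:
  assumes u: "u \<in> topspace (nsphere 2)"
  shows "rotation u pi \<noteq> mat 1"
proof
  assume "rotation u pi = mat 1"
  then have "(rotation u pi) $ i $ i = (mat 1 :: real ^ 3 ^ 3) $ i $ i" for i
    by simp
  from this [of 1] this [of 2] this [of 3] show False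
    using u by (simp add: rotation_def skew_matrix_square sphere_2_iff mat_def)
qed

lemma vector_3_eq_lambda:
  "vector [x, y, z] = (\<chi> i::3. if i = 1 then x else if i = 2 then y else (z :: 'b::zero))"
  by (simp add: vec_eq_iff forall_3)

lemma continuous_on_vector_3:
  fixes f g h :: "'a::topological_space \<Rightarrow> 'b::{topological_space, zero}"
  assumes "continuous_on S f" "continuous_on S g" "continuous_on S h"
  shows "continuous_on S (\<lambda>x. vector [f x, g x, h x] :: 'b ^ 3)"
  unfolding vector_3_eq_lambda
proof (rule continuous_on_vec_lambda)
  show "continuous_on S (\<lambda>x. if i = 1 then f x else if i = 2 then g x else h x)" for i :: 3
    using assms by (cases "i = 1"; cases "i = 2") simp_all
qed

lemma continuous_map_rotation:
  "continuous_map (prod_topology euclideanreal (nsphere 2)) SO3_top (\<lambda>(t, u). rotation u t)"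
proof -
  let ?X = "prod_topology euclideanreal (nsphere 2)"
  define g :: "real \<times> real \<times> real \<times> real \<Rightarrow> real ^ 3 ^ 3" where
    "g = (\<lambda>(t, a, b, c). mat 1 + sin t *\<^sub>R skew_matrix a b c
       + (1 - cos t) *\<^sub>R (vector [vector [- (b\<^sup>2 + c\<^sup>2), a * b, a * c], vector [a * b, - (a\<^sup>2 + c\<^sup>2), b * c],
       vector [a * c, b * c, - (a\<^sup>2 + b\<^sup>2)]]))"
  have "continuous_on UNIV g"
    unfolding g_def case_prod_unfold skew_matrix_def
    by (intro continuous_intros continuous_on_vector_3)
  then have g: "continuous_map euclidean euclidean g"
    by simp
  have snd: "continuous_map ?X euclideanreal (\<lambda>p. snd p i)" for i
    using continuous_map_compose [OF continuous_map_snd continuous_map_nsphere_projection, of euclideanreal 2 i]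
    by (simp add: o_def)
  have "continuous_map ?X (prod_topology euclidean (prod_topology euclidean (prod_topology euclidean euclidean)))
      (\<lambda>p. (fst p, snd p 0, snd p 1, snd p 2))"
    by (intro continuous_map_paired [THEN iffD2] conjI snd continuous_map_fst)
  then have "continuous_map ?X euclidean (\<lambda>p. (fst p, snd p 0, snd p 1, snd p 2))"
    by simp
  then have "continuous_map ?X euclidean (g \<circ> (\<lambda>p. (fst p, snd p 0, snd p 1, snd p 2)))"
    by (rule continuous_map_compose [OF _ g])
  also have "g \<circ> (\<lambda>p. (fst p, snd p 0, snd p 1, snd p 2)) = (\<lambda>(t, u). rotation u t)"
    by (auto simp: g_def rotation_def skew_matrix_square)
  finally show ?thesis
    by (auto simp: SO3_top_def continuous_map_in_subtopology rotation_in_SO3)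
qed

section \<open>Projective space\<close>

lemma antipodal_class_eq: "antipodal_class x = {x, antipode x}"
  by (simp add: antipodal_class_def antipode_def)

lemma antipodal_class_antipode [simp]: "antipodal_class (antipode x) = antipodal_class x"
  by (auto simp: antipodal_class_eq)

lemma antipodal_class_eq_iff: "antipodal_class x = antipodal_class y \<longleftrightarrow> x = y \<or> x = antipode y"
  by (auto simp: antipodal_class_eq doubleton_eq_iff)

lemma topspace_real_projective_space:
  "topspace (real_projective_space n) = antipodal_class ` topspace (nsphere n)"
  by (simp add: real_projective_space_def)

lemma continuous_map_antipodal_class:
  "continuous_map (nsphere n) (real_projective_space n) antipodal_class"
  unfolding real_projective_space_def
  by (rule quotient_imp_continuous_map [OF quotient_map_quotient_topology])

text \<open>The products \<open>x\<^sub>i x\<^sub>j\<close> of homogeneous coordinates do not depend on the sign of \<open>x\<close>. They are continuous real functions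
on projective space, through which continuity can be transported back to the sphere.\<close>

definition veronese :: "nat \<Rightarrow> nat \<Rightarrow> (nat \<Rightarrow> real) set \<Rightarrow> real" where
  "veronese i j p = (let x = SOME x. x \<in> p in x i * x j)"

lemma veronese_antipodal_class: "veronese i j (antipodal_class x) = x i * x j"
proof -
  have "(SOME y. y \<in> antipodal_class x) \<in> antipodal_class x"
    by (rule someI [of _ x]) (simp add: antipodal_class_eq)
  then show ?thesis
    by (auto simp: veronese_def antipodal_class_eq antipode_apply Let_def)
qed

lemma continuous_map_veronese:
  "continuous_map (real_projective_space n) euclideanreal (veronese i j)"
  unfolding real_projective_space_def
proof (rule continuous_compose_quotient_map [OF quotient_map_quotient_topology])
  show "continuous_map (nsphere n) euclideanreal (veronese i j \<circ> antipodal_class)"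
    by (simp add: o_def veronese_antipodal_class continuous_map_real_mult continuous_map_nsphere_projection)
qed

lemma compact_space_nsphere: "compact_space (nsphere n)"
proof -
  let ?X = "powertop_real UNIV" and ?S = "topspace (nsphere n)"
  have eq: "?S = (\<Inter>i \<in> {n<..}. {x \<in> topspace ?X. x i \<in> {0}}) \<inter>
              {x \<in> topspace ?X. (\<Sum>i\<le>n. (x i)\<^sup>2) \<in> {1}}"
    by (auto simp: topspace_nsphere)
  have "closedin ?X ?S"
    unfolding eq
    by (rule closedin_Int closedin_Inter continuous_map_sum continuous_map_real_pow
             continuous_map_product_projection closedin_continuous_map_preimage | force | clarify)+
  moreover have "?S \<subseteq> UNIV \<rightarrow>\<^sub>E {-1..1}"
    using topspace_nsphere_1 abs_square_le_1 by (fastforce simp: abs_le_iff)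
  moreover have "compactin ?X (UNIV \<rightarrow>\<^sub>E {-1..1})"
    by (simp add: compactin_PiE)
  ultimately have "compactin ?X ?S"
    using closed_compactin by blast
  then show ?thesis
    by (simp add: compact_space_def nsphere compactin_subtopology)
qed

section \<open>Lifting the action\<close>

text \<open>A lift to the sphere of the action of all rotations by the angle \<open>t\<close>, continuous in the axis \<open>u\<close> as well. The last two
clauses are consequences of the canonical choice of lifts for small angles; they are carried along because they pass to
doubled angles.\<close>

definition lifts_rotation ::
  "nat \<Rightarrow> (real ^ 3 ^ 3 \<Rightarrow> (nat \<Rightarrow> real) set \<Rightarrow> (nat \<Rightarrow> real) set) \<Rightarrow> real
    \<Rightarrow> ((nat \<Rightarrow> real) \<times> (nat \<Rightarrow> real) \<Rightarrow> nat \<Rightarrow> real) \<Rightarrow> bool" where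
  "lifts_rotation n \<phi> t L \<longleftrightarrow>
     continuous_map (prod_topology (nsphere 2) (nsphere n)) (nsphere n) L \<and>
     (\<forall>u\<in>topspace (nsphere 2). \<forall>x\<in>topspace (nsphere n).
        antipodal_class (L (u, x)) = \<phi> (rotation u t) (antipodal_class x) \<and>
        L (u, antipode x) = antipode (L (u, x)) \<and>
        L (antipode u, L (u, x)) = x)"

lemma continuous_action_simps:
  assumes act: "continuous_action SO3 SO3_top X \<phi>"
  shows "\<And>g p. g \<in> carrier SO3 \<Longrightarrow> p \<in> topspace X \<Longrightarrow> \<phi> g p \<in> topspace X"
    and "\<And>g h p. g \<in> carrier SO3 \<Longrightarrow> h \<in> carrier SO3 \<Longrightarrow> p \<in> topspace X \<Longrightarrow>
           \<phi> g (\<phi> h p) = \<phi> (g ** h) p"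
    and "\<And>p. p \<in> topspace X \<Longrightarrow> \<phi> (mat 1) p = p"
proof -
  interpret group_action SO3 "topspace X" \<phi>
    using act by (simp add: continuous_action_def)
  show "\<phi> g p \<in> topspace X" if "g \<in> carrier SO3" "p \<in> topspace X" for g p
    using element_image that by blast
  show "\<phi> g (\<phi> h p) = \<phi> (g ** h) p"
    if "g \<in> carrier SO3" "h \<in> carrier SO3" "p \<in> topspace X" for g h p
    using composition_rule [of p g h] that by (simp add: SO3_def)
  show "\<phi> (mat 1) p = p" if "p \<in> topspace X" for p
    using fun_cong [OF id_eq_one, of p] that by (simp add: SO3_def)
qed

text \<open>Rotating twice by \<open>t\<close> is rotating by \<open>2 t\<close>. Thus lifts for small angles are enough, and neither
covering space theory nor the universal cover of the rotation group is used.\<close>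

lemma lifts_rotation_double:
  assumes act: "continuous_action SO3 SO3_top (real_projective_space n) \<phi>"
    and L: "lifts_rotation n \<phi> t L"
  shows "lifts_rotation n \<phi> (2 * t) (\<lambda>(u, x). L (u, L (u, x)))"
proof -
  let ?P = "prod_topology (nsphere 2) (nsphere n)"
  note simps = continuous_action_simps [OF act]
  have cL: "continuous_map ?P (nsphere n) L"
    using L by (simp add: lifts_rotation_def)
  have Lx: "L (u, x) \<in> topspace (nsphere n)"
    if "u \<in> topspace (nsphere 2)" "x \<in> topspace (nsphere n)" for u x
    using continuous_map_funspace [OF cL] that by auto
  have "continuous_map ?P ?P (\<lambda>p. (fst p, L p))"
    using cL by (simp add: continuous_map_pairwise o_def continuous_map_fst)
  from continuous_map_compose [OF this cL]
  have "continuous_map ?P (nsphere n) (\<lambda>(u, x). L (u, L (u, x)))"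
    by (simp add: o_def case_prod_unfold)
  moreover have "antipodal_class (L (u, L (u, x))) = \<phi> (rotation u (2 * t)) (antipodal_class x)"
    if u: "u \<in> topspace (nsphere 2)" and x: "x \<in> topspace (nsphere n)" for u x
  proof -
    have "antipodal_class (L (u, L (u, x))) = \<phi> (rotation u t) (\<phi> (rotation u t) (antipodal_class x))"
      using L u x Lx [OF u x] by (simp add: lifts_rotation_def)
    also have "\<dots> = \<phi> (rotation u t ** rotation u t) (antipodal_class x)"
      using x by (intro simps(2) rotation_in_SO3 [OF u]) (simp add: topspace_real_projective_space)
    finally show ?thesis
      by (simp add: rotation_add [OF u])
  qed
  moreover have "L (antipode u, L (antipode u, L (u, L (u, x)))) = x \<and>
      L (u, L (u, antipode x)) = antipode (L (u, L (u, x)))"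
    if u: "u \<in> topspace (nsphere 2)" and x: "x \<in> topspace (nsphere n)" for u x
    using L u x Lx [OF u x] by (simp add: lifts_rotation_def)
  ultimately show ?thesis
    by (simp add: lifts_rotation_def)
qed

lemma continuous_map_displaced_coordinates:
  assumes act: "continuous_action SO3 SO3_top (real_projective_space n) \<phi>"
  shows "continuous_map (prod_topology euclideanreal (prod_topology (nsphere 2) (nsphere n))) euclideanreal
     (\<lambda>(t, u, x). veronese i j (\<phi> (rotation u t) (antipodal_class x)))"
proof -
  let ?X = "prod_topology euclideanreal (prod_topology (nsphere 2) (nsphere n))"
  let ?P = "real_projective_space n"
  have "continuous_map ?X (prod_topology euclideanreal (nsphere 2)) (\<lambda>p. (fst p, fst (snd p)))"
    by (simp add: continuous_map_pairwise o_def continuous_map_fst continuous_map_of_snd [unfolded o_def])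
  from continuous_map_compose [OF this continuous_map_rotation]
  have R: "continuous_map ?X SO3_top (\<lambda>p. rotation (fst (snd p)) (fst p))"
    by (simp add: o_def)
  have "continuous_map ?X (nsphere n) (\<lambda>p. snd (snd p))"
    by (simp add: continuous_map_of_snd [unfolded o_def] continuous_map_snd)
  from continuous_map_compose [OF this continuous_map_antipodal_class]
  have Q: "continuous_map ?X ?P (\<lambda>p. antipodal_class (snd (snd p)))"
    by (simp add: o_def)
  have "continuous_map (prod_topology SO3_top ?P) ?P (\<lambda>(g, p). \<phi> g p)"
    using act by (simp add: continuous_action_def)
  from continuous_map_compose [OF continuous_map_paired [THEN iffD2, OF conjI [OF R Q]] this]
  have "continuous_map ?X ?P (\<lambda>p. \<phi> (rotation (fst (snd p)) (fst p)) (antipodal_class (snd (snd p))))"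
    by (simp add: o_def)
  from continuous_map_compose [OF this continuous_map_veronese]
  show ?thesis
    by (simp add: o_def case_prod_unfold)
qed

text \<open>The double sum is the square of the inner product of \<open>x\<close> with a representative of its image class. It equals \<open>1\<close> for the
trivial rotation and is continuous, so by compactness it stays positive for all axes and all points if the angle is small.\<close>

lemma small_rotation_not_orthogonal:
  assumes act: "continuous_action SO3 SO3_top (real_projective_space n) \<phi>"
  shows "\<exists>k. \<forall>u\<in>topspace (nsphere 2). \<forall>x\<in>topspace (nsphere n).
    0 < (\<Sum>i\<le>n. \<Sum>j\<le>n. veronese i j (\<phi> (rotation u (pi / 2 ^ k)) (antipodal_class x)) * x i * x j)"
proof -
  let ?K = "prod_topology (nsphere 2) (nsphere n)" and ?P = "real_projective_space n"
  let ?X = "prod_topology euclideanreal ?K"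
  define N where "N = (\<lambda>(t, u, x). \<Sum>i\<le>n. \<Sum>j\<le>n. veronese i j (\<phi> (rotation u t) (antipodal_class x)) * x i * x j)"
  have co: "continuous_map ?X euclideanreal (\<lambda>p. snd (snd p) i)" for i
    using continuous_map_compose [OF continuous_map_snd [of euclideanreal ?K]
        continuous_map_compose [OF continuous_map_snd continuous_map_nsphere_projection]]
    by (simp add: o_def)
  have "continuous_map ?X euclideanreal N"
    unfolding N_def case_prod_unfold
    by (intro continuous_map_sum continuous_map_real_mult co
        continuous_map_displaced_coordinates [OF act, unfolded case_prod_unfold]) auto
  then have W: "openin ?X {p \<in> topspace ?X. N p \<in> {0<..}}"
    by (rule openin_continuous_map_preimage) simp
  have "N (0, u, x) = 1" if x: "x \<in> topspace (nsphere n)" for u x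
  proof -
    have "\<phi> (rotation u 0) (antipodal_class x) = antipodal_class x"
      using continuous_action_simps(3) [OF act] x by (simp add: topspace_real_projective_space)
    then have "N (0, u, x) = (\<Sum>i\<le>n. \<Sum>j\<le>n. (x i)\<^sup>2 * (x j)\<^sup>2)"
      by (simp add: N_def veronese_antipodal_class power2_eq_square mult_ac)
    also have "\<dots> = (\<Sum>i\<le>n. (x i)\<^sup>2) * (\<Sum>j\<le>n. (x j)\<^sup>2)"
      by (rule sum_product [symmetric])
    finally show ?thesis
      using x by (simp add: topspace_nsphere)
  qed
  then have sub: "{0} \<times> topspace ?K \<subseteq> {p \<in> topspace ?X. N p \<in> {0<..}}"
    by auto
  have "compact_space ?K"
    using compact_space_nsphere by (simp add: compact_space_prod_topology)
  then have K: "compactin ?K (topspace ?K)"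
    by (simp only: compact_space_def)
  have "compactin euclideanreal {0}"
    by simp
  then obtain U V where "openin euclideanreal U" "openin ?K V" "{0} \<subseteq> U" and V: "topspace ?K \<subseteq> V"
    and UV: "U \<times> V \<subseteq> {p \<in> topspace ?X. N p \<in> {0<..}}"
    by (rule Wallace_theorem_prod_topology [OF _ K W sub])
  then have U: "open U" "0 \<in> U"
    by auto
  have "(\<lambda>k. pi / 2 ^ k) \<longlonglongrightarrow> 0"
    using LIMSEQ_divide_realpow_zero [of 2 pi] by simp
  then have "eventually (\<lambda>k. pi / 2 ^ k \<in> U) sequentially"
    using U by (rule topological_tendstoD)
  then obtain k where k: "pi / 2 ^ k \<in> U"
    by (auto simp: eventually_sequentially)
  have "0 < N (pi / 2 ^ k, u, x)" if "u \<in> topspace (nsphere 2)" "x \<in> topspace (nsphere n)" for u x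
  proof -
    have "(pi / 2 ^ k, u, x) \<in> U \<times> V"
      using k V that by auto
    then show ?thesis using UV by auto
  qed
  then show ?thesis
    by (auto simp: N_def)
qed

text \<open>If no point is moved to an orthogonal line, then the lift can be chosen canonically: of the two representatives
of the image of \<open>x\<close> take the one, \<open>z\<close>, with positive inner product with \<open>x\<close>. The formula for \<open>L\<close> is
\<open>z \<langle>z, x\<rangle> / \<bar>\<langle>z, x\<rangle>\<bar>\<close>, which is insensitive to the sign of \<open>z\<close> and hence continuous. The condition is symmetric in \<open>x\<close> and \<open>z\<close>, which makes
the lift of the inverse rotation the inverse of the lift.\<close>

lemma small_lift_exists:
  assumes act: "continuous_action SO3 SO3_top (real_projective_space n) \<phi>"
    and pos: "\<And>u x. u \<in> topspace (nsphere 2) \<Longrightarrow> x \<in> topspace (nsphere n) \<Longrightarrow>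
       0 < (\<Sum>i\<le>n. \<Sum>j\<le>n. veronese i j (\<phi> (rotation u t) (antipodal_class x)) * x i * x j)"
  shows "\<exists>L. lifts_rotation n \<phi> t L"
proof -
  let ?K = "prod_topology (nsphere 2) (nsphere n)" and ?P = "real_projective_space n"
  note simps = continuous_action_simps [OF act]
  define M where "M = (\<lambda>i j p. veronese i j (\<phi> (rotation (fst p) t) (antipodal_class (snd p))))"
  define N where "N = (\<lambda>p. \<Sum>i\<le>n. \<Sum>j\<le>n. M i j p * snd p i * snd p j)"
  define L where "L = (\<lambda>p i. (\<Sum>j\<le>n. M i j p * snd p j) / sqrt (N p))"
  have L_eq: "L (u, x) = z"
    if x: "x \<in> topspace (nsphere n)" and z: "antipodal_class z = \<phi> (rotation u t) (antipodal_class x)"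
      and zx: "0 < (\<Sum>j\<le>n. z j * x j)" for u x z
  proof -
    have M: "M i j (u, x) = z i * z j" for i j
      by (simp add: M_def veronese_antipodal_class flip: z)
    have "N (u, x) = (\<Sum>i\<le>n. \<Sum>j\<le>n. (z i * x i) * (z j * x j))"
      by (simp add: N_def M mult_ac)
    also have "\<dots> = (\<Sum>j\<le>n. z j * x j)\<^sup>2"
      by (simp add: power2_eq_square sum_product)
    finally have "sqrt (N (u, x)) = (\<Sum>j\<le>n. z j * x j)"
      using zx by simp
    moreover have "(\<Sum>j\<le>n. M i j (u, x) * x j) = z i * (\<Sum>j\<le>n. z j * x j)" for i
      by (simp add: M sum_distrib_left mult_ac)
    ultimately show ?thesis
      using zx by (auto simp: L_def)
  qed
  have ex: "\<exists>z \<in> topspace (nsphere n). antipodal_class z = \<phi> (rotation u t) (antipodal_class x)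
      \<and> 0 < (\<Sum>j\<le>n. z j * x j)"
    if u: "u \<in> topspace (nsphere 2)" and x: "x \<in> topspace (nsphere n)" for u x
  proof -
    have "\<phi> (rotation u t) (antipodal_class x) \<in> topspace ?P"
      using x by (intro simps(1) rotation_in_SO3 [OF u]) (simp add: topspace_real_projective_space)
    then obtain y where y: "y \<in> topspace (nsphere n)"
        "\<phi> (rotation u t) (antipodal_class x) = antipodal_class y"
      by (auto simp: topspace_real_projective_space)
    have "0 < (\<Sum>i\<le>n. \<Sum>j\<le>n. (y i * x i) * (y j * x j))"
      using pos [OF u x] by (simp add: y(2) veronese_antipodal_class mult_ac)
    then have "(\<Sum>j\<le>n. y j * x j) \<noteq> 0"
      by (auto simp flip: sum_product)
    moreover have "(\<Sum>j\<le>n. antipode y j * x j) = - (\<Sum>j\<le>n. y j * x j)"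
      by (simp add: antipode_apply sum_negf)
    ultimately consider "0 < (\<Sum>j\<le>n. y j * x j)" | "0 < (\<Sum>j\<le>n. antipode y j * x j)"
      by linarith
    then show ?thesis
    proof cases
      case 1
      then show ?thesis using y by auto
    next
      case 2
      then show ?thesis using y by (intro bexI [of _ "antipode y"]) auto
    qed
  qed
  have Lp: "L (u, x) \<in> topspace (nsphere n)"
      "antipodal_class (L (u, x)) = \<phi> (rotation u t) (antipodal_class x)"
      "0 < (\<Sum>j\<le>n. L (u, x) j * x j)"
    if u: "u \<in> topspace (nsphere 2)" and x: "x \<in> topspace (nsphere n)" for u x
    using ex [OF u x] L_eq [OF x] by auto
  have co: "continuous_map ?K euclideanreal (\<lambda>p. snd p i)" for i
    using continuous_map_compose [OF continuous_map_snd continuous_map_nsphere_projection] by (simp add: o_def)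
  have "continuous_map ?K (prod_topology euclideanreal ?K) (\<lambda>p. (t, fst p, snd p))"
    by (simp add: continuous_map_pairwise o_def continuous_map_fst continuous_map_snd)
  from continuous_map_compose [OF this continuous_map_displaced_coordinates [OF act]]
  have M: "continuous_map ?K euclideanreal (M i j)" for i j
    by (simp add: o_def M_def case_prod_unfold)
  have Npos: "0 < N p" if "p \<in> topspace ?K" for p
    using pos [of "fst p" "snd p"] that by (auto simp: N_def M_def)
  have N: "continuous_map ?K euclideanreal N"
    unfolding N_def by (intro continuous_map_sum continuous_map_real_mult M co) auto
  have "continuous_map ?K (nsphere n) L"
    unfolding continuous_map_into_nsphere
  proof (intro conjI allI)
    show "continuous_map ?K euclideanreal (\<lambda>p. L p i)" for i
      unfolding L_def
      by (intro continuous_map_real_divide continuous_map_sum continuous_map_real_mult M co continuous_map_sqrt N)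
        (use Npos in force)+
    show "L \<in> topspace ?K \<rightarrow> topspace (nsphere n)"
      using Lp(1) by auto
  qed
  moreover have "L (u, antipode x) = antipode (L (u, x))"
    if u: "u \<in> topspace (nsphere 2)" and x: "x \<in> topspace (nsphere n)" for u x
    using Lp [OF u x] x by (intro L_eq) (simp_all add: antipode_apply)
  moreover have "L (antipode u, L (u, x)) = x"
    if u: "u \<in> topspace (nsphere 2)" and x: "x \<in> topspace (nsphere n)" for u x
  proof (rule L_eq [OF Lp(1) [OF u x]])
    have au: "antipode u \<in> topspace (nsphere 2)"
      using u by simp
    have qx: "antipodal_class x \<in> topspace ?P"
      using x by (simp add: topspace_real_projective_space)
    have "\<phi> (rotation (antipode u) t) (antipodal_class (L (u, x)))
        = \<phi> (rotation (antipode u) t ** rotation u t) (antipodal_class x)"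
      unfolding Lp(2) [OF u x] by (rule simps(2) [OF rotation_in_SO3 [OF au] rotation_in_SO3 [OF u] qx])
    also have "rotation (antipode u) t ** rotation u t = mat 1"
      by (simp add: rotation_antipode rotation_add [OF u])
    finally show "antipodal_class x = \<phi> (rotation (antipode u) t) (antipodal_class (L (u, x)))"
      using simps(3) [OF qx] by simp
    show "0 < (\<Sum>j\<le>n. x j * L (u, x) j)"
      using Lp(3) [OF u x] by (simp add: mult.commute)
  qed
  ultimately have "lifts_rotation n \<phi> t L"
    using Lp(2) by (simp add: lifts_rotation_def)
  then show ?thesis by blast
qed

lemma half_turn_lift_exists:
  assumes act: "continuous_action SO3 SO3_top (real_projective_space n) \<phi>"
  shows "\<exists>G. lifts_rotation n \<phi> pi G"
proof -
  obtain k where "\<exists>L. lifts_rotation n \<phi> (pi / 2 ^ k) L"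
    using small_rotation_not_orthogonal [OF act] small_lift_exists [OF act] by blast
  moreover have "(\<exists>L. lifts_rotation n \<phi> (pi / 2 ^ k) L) \<Longrightarrow> ?thesis" for k
  proof (induction k)
    case (Suc k)
    then obtain L where "lifts_rotation n \<phi> (pi / 2 ^ Suc k) L" by blast
    from lifts_rotation_double [OF act this] show ?case
      by (intro Suc.IH) auto
  qed simp
  ultimately show ?thesis by blast
qed

text \<open>The square of a half turn is trivial, so its lift sends \<open>x\<close> to \<open>x\<close> or \<open>- x\<close>. The sign is continuous, and the product of
the two spheres is connected.\<close>

lemma half_turn_lift_square:
  assumes n: "0 < n" and act: "continuous_action SO3 SO3_top (real_projective_space n) \<phi>"
    and G: "lifts_rotation n \<phi> pi G"
  shows "(\<forall>u\<in>topspace (nsphere 2). \<forall>x\<in>topspace (nsphere n). G (u, G (u, x)) = x) \<or>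
    (\<forall>u\<in>topspace (nsphere 2). \<forall>x\<in>topspace (nsphere n). G (u, G (u, x)) = antipode x)"
proof -
  let ?K = "prod_topology (nsphere 2) (nsphere n)"
  define G2 where "G2 = (\<lambda>(u, x). G (u, G (u, x)))"
  have G2: "lifts_rotation n \<phi> (2 * pi) G2"
    unfolding G2_def by (rule lifts_rotation_double [OF act G])
  have pm: "G2 (u, x) = x \<or> G2 (u, x) = antipode x"
    if u: "u \<in> topspace (nsphere 2)" and x: "x \<in> topspace (nsphere n)" for u x
  proof -
    have "antipodal_class (G2 (u, x)) = antipodal_class x"
      using G2 u x continuous_action_simps(3) [OF act, of "antipodal_class x"]
      by (simp add: lifts_rotation_def rotation_2pi topspace_real_projective_space)
    then show ?thesis
      by (simp add: antipodal_class_eq_iff)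
  qed
  define s where "s = (\<lambda>p. \<Sum>i\<le>n. G2 p i * snd p i)"
  have xx: "(\<Sum>i\<le>n. x i * x i) = 1" if "x \<in> topspace (nsphere n)" for x
    using that by (simp add: topspace_nsphere power2_eq_square)
  have sval: "s (u, x) = (if G2 (u, x) = x then 1 else -1)"
    if u: "u \<in> topspace (nsphere 2)" and x: "x \<in> topspace (nsphere n)" for u x
    using pm [OF u x] xx [OF x] by (auto simp: s_def antipode_apply sum_negf)
  have G2c: "continuous_map ?K euclideanreal (\<lambda>p. G2 p i)" for i
    using G2 by (simp add: lifts_rotation_def continuous_map_into_nsphere)
  have co: "continuous_map ?K euclideanreal (\<lambda>p. snd p i)" for i
    using continuous_map_compose [OF continuous_map_snd continuous_map_nsphere_projection] by (simp add: o_def)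
  have s: "continuous_map ?K euclideanreal s"
    unfolding s_def by (intro continuous_map_sum continuous_map_real_mult G2c co) auto
  have "connected_space ?K"
    using path_connected_nsphere [of 2] path_connected_nsphere [OF n]
    by (simp add: connected_space_prod_topology path_connected_imp_connected_space)
  then have "connectedin ?K (topspace ?K)"
    by (simp only: connectedin_topspace)
  then have "connectedin euclideanreal (s ` topspace ?K)"
    by (rule connectedin_continuous_map_image [OF s])
  then have conn: "connected (s ` topspace ?K)"
    by simp
  have sub: "s ` topspace ?K \<subseteq> {1, -1}"
    using sval by auto
  then have "finite (s ` topspace ?K)"
    by (rule finite_subset) simp
  then have sing: "s ` topspace ?K = {} \<or> (\<exists>a. s ` topspace ?K = {a})"
    using connected_finite_iff_sing [OF conn] by simp
  have same: "s p = s q" if "p \<in> topspace ?K" "q \<in> topspace ?K" for p q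
    using sing imageI [OF that(1), of s] imageI [OF that(2), of s] by (metis empty_iff singletonD)
  show ?thesis
  proof (cases "\<forall>p\<in>topspace ?K. s p = 1")
    case True
    have "G2 (u, x) = x" if u: "u \<in> topspace (nsphere 2)" and x: "x \<in> topspace (nsphere n)" for u x
    proof -
      have "s (u, x) = 1" using True u x by simp
      then show ?thesis using sval [OF u x] by (simp split: if_splits)
    qed
    then show ?thesis by (simp add: G2_def)
  next
    case False
    then obtain q where q: "q \<in> topspace ?K" "s q \<noteq> 1" by blast
    have "G2 (u, x) = antipode x" if u: "u \<in> topspace (nsphere 2)" and x: "x \<in> topspace (nsphere n)" for u x
    proof -
      have "s (u, x) \<noteq> 1" using same [OF _ q(1), of "(u, x)"] q(2) u x by simp
      then show ?thesis using sval [OF u x] pm [OF u x] by auto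
    qed
    then show ?thesis by (simp add: G2_def)
  qed
qed

section \<open>Free actions on projective space\<close>

text \<open>If the lifts of half turns are involutions, one of them contradicts the theorem on involutions: by freeness of the
action it never sends \<open>x\<close> to \<open>x\<close> or \<open>- x\<close>. Otherwise the lift is odd in the axis too, as \<open>G (-u)\<close> is the inverse
of \<open>G u\<close>, and the binomial coefficients \<open>n choose 1\<close> and \<open>n choose 2\<close> are odd; this happens only if \<open>n\<close> is \<open>3\<close> modulo \<open>4\<close>.\<close>

theorem theorem4p1:
  fixes n :: nat
  assumes "n \<ge> 1"
    and "n mod 4 = 0 \<or> n mod 4 = 1 \<or> n mod 4 = 2"
  shows "\<not> (\<exists>\<phi>. continuous_action SO3 SO3_top (real_projective_space n) \<phi> \<and>
                free_action SO3 (topspace (real_projective_space n)) \<phi>)"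
proof
  assume "\<exists>\<phi>. continuous_action SO3 SO3_top (real_projective_space n) \<phi> \<and>
                free_action SO3 (topspace (real_projective_space n)) \<phi>"
  then obtain \<phi> where act: "continuous_action SO3 SO3_top (real_projective_space n) \<phi>"
    and free: "free_action SO3 (topspace (real_projective_space n)) \<phi>"
    by blast
  have n: "0 < n" using assms(1) by simp
  obtain G where G: "lifts_rotation n \<phi> pi G"
    using half_turn_lift_exists [OF act] by blast
  have cG: "continuous_map (prod_topology (nsphere 2) (nsphere n)) (nsphere n) G"
    using G by (simp add: lifts_rotation_def)
  have Gx: "G (u, x) \<in> topspace (nsphere n)"
    if "u \<in> topspace (nsphere 2)" "x \<in> topspace (nsphere n)" for u x
    using continuous_map_funspace [OF cG] that by auto
  from half_turn_lift_square [OF n act G] show False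
  proof
    assume sq: "\<forall>u\<in>topspace (nsphere 2). \<forall>x\<in>topspace (nsphere n). G (u, G (u, x)) = x"
    obtain u where u: "u \<in> topspace (nsphere 2)"
      using in_topspace_nsphere by blast
    have "continuous_map (nsphere n) (prod_topology (nsphere 2) (nsphere n)) (\<lambda>x. (u, x))"
      using u by (simp add: continuous_map_pairwise o_def)
    from continuous_map_compose [OF this cG]
    have "continuous_map (nsphere n) (nsphere n) (\<lambda>x. G (u, x))"
      by (simp add: o_def)
    then obtain x where x: "x \<in> topspace (nsphere n)" "G (u, x) = x \<or> G (u, x) = antipode x"
      using involution_of_sphere_meets_antipode [OF n, of "\<lambda>x. G (u, x)"] sq u by blast
    then have "\<phi> (rotation u pi) (antipodal_class x) = antipodal_class x"
      using G u by (metis antipodal_class_antipode lifts_rotation_def)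
    then have "rotation u pi \<in> stabilizer SO3 \<phi> (antipodal_class x)"
      by (simp add: stabilizer_def rotation_in_SO3 [OF u])
    then have "rotation u pi = mat 1"
      using free x(1) by (simp add: free_action_def topspace_real_projective_space SO3_def)
    then show False
      using half_turn_nontrivial [OF u] by simp
  next
    assume sq: "\<forall>u\<in>topspace (nsphere 2). \<forall>x\<in>topspace (nsphere n). G (u, G (u, x)) = antipode x"
    have odd1: "G (antipode u, x) = antipode (G (u, x))"
      if u: "u \<in> topspace (nsphere 2)" and x: "x \<in> topspace (nsphere n)" for u x
    proof -
      have "G (antipode u, G (u, G (u, x))) = G (u, x)"
        using G u Gx [OF u x] by (simp add: lifts_rotation_def)
      then have "G (antipode u, antipode x) = G (u, x)"
        using sq u x by simp
      moreover have "G (antipode u, antipode x) = antipode (G (antipode u, x))"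
        using G u x by (simp add: lifts_rotation_def)
      ultimately show ?thesis
        by (metis antipode_antipode)
    qed
    have "odd (n choose k)" if "k \<le> 2" for k
      using bi_odd_map_binomials_odd [OF n cG odd1 _ that] G by (simp add: lifts_rotation_def)
    from this [of 1] this [of 2] have n1: "odd n" and n2: "odd (n * (n - 1) div 2)"
      by (simp_all add: choose_two)
    then have "n mod 4 = 1"
      using assms(2) by presburger
    then obtain m where "n = 4 * m + 1"
      by (metis mult.commute mod_mult_div_eq add.commute)
    then have "n * (n - 1) div 2 = 2 * (m * n)"
      by simp
    then show False
      using n2 by simp
  qed
qed

end
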